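(* Let $X_k=\mathbb{R}^{m_k}$ for some $m_k\in\mathbb{N}$, and for $k=1,2,\dots,m$ let $\{(X_k;w_{ki_k}): i_k=1,2,\dots,N_k\}$ be IFSs whose maps $w_{ki_k}$ are similarities with contraction similarity $c_{ki_k}<1$, each satisfying the open set condition (OSC). If $F=\prod_{k=1}^m F_k$ is the attractor of the product IFS $\{(X;T_{i_1i_2\ldots i_m}): 1\le i_k\le N_k,\ k=1,2,\dots,m\}$, then $$\dim_H F=\dim_B F=\sum_{k=1}^m s_k,$$ where, for $k=1,2,\dots,m$, $s_k$ is the solution of the equation $\sum_{i_k=1}^{N_k}c_{ki_k}^{s_k}=1$.
   Context: $\mathbb{R}^{m_k}$ carries the Euclidean metric, and $X=\prod_{k=1}^m X_k$ carries the product metric $d_0(\vec{x},\vec{y})=\left(\sum_{k=1}^m d_k(x_k,y_k)^2\right)^{1/2}$. A map $f$ on a metric space $(Y,d)$ has contraction similarity $c\in[0,1)$ if $d(f(x),f(y))=c\,d(x,y)$ for all $x,y$. An IFS is a finite family of contractions $f_1,\dots,f_N$ of a complete metric space $Y$; its attractor is the unique nonempty compact set $B$ with $B=\bigcup_{i=1}^N f_i(B)$. It satisfies the open set condition (OSC) if there is a nonempty bounded open set $V\subseteq Y$ with $\bigcup_{i=1}^N f_i(V)\subseteq V$ and $f_i(V)\cap f_j(V)=\emptyset$ for $i\ne j$. The product IFS consists of the maps $T_{i_1\ldots i_m}:X\to X$, $T_{i_1\ldots i_m}(\vec{x})=(w_{1i_1}(x_1),\dots,w_{mi_m}(x_m))$.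 $F_k$ is the attractor of $\{(X_k;w_{ki_k}): i_k=1,\dots,N_k\}$. $\dim_H$ denotes Hausdorff dimension. For a compact set $F$, with $N_r(F)$ the smallest number of balls of radius $r$ covering $F$, the upper and lower box dimensions are the $\limsup$ and $\liminf$ as $r\to0$ of $\log N_r(F)/(-\log r)$; if they coincide the common value is the box dimension $\dim_B F$ (the claim includes its existence). *)

theory Defs
  imports "HOL-Analysis.Analysis"
begin

context Metric_space
begin

definition contraction_similarity :: "('a \<Rightarrow> 'a) \<Rightarrow> real \<Rightarrow> bool" where
  "contraction_similarity f c \<longleftrightarrow>
     f \<in> M \<rightarrow> M \<and> 0 \<le> c \<and> c < 1 \<and> (\<forall>x\<in>M. \<forall>y\<in>M. d (f x) (f y) = c * d x y)"

definition contraction :: "('a \<Rightarrow> 'a) \<Rightarrow> bool" where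
  "contraction f \<longleftrightarrow>
     f \<in> M \<rightarrow> M \<and> (\<exists>c. 0 \<le> c \<and> c < 1 \<and> (\<forall>x\<in>M. \<forall>y\<in>M. d (f x) (f y) \<le> c * d x y))"

definition IFS :: "'i set \<Rightarrow> ('i \<Rightarrow> 'a \<Rightarrow> 'a) \<Rightarrow> bool" where
  "IFS I f \<longleftrightarrow> mcomplete \<and> finite I \<and> I \<noteq> {} \<and> (\<forall>i\<in>I. contraction (f i))"

text \<open>For an IFS there is exactly one such \<open>B\<close> (Hutchinson), so for an IFS this relation
  determines the attractor. \<open>compactin mtopology B\<close> includes \<open>B \<subseteq> M\<close>.\<close>

definition is_attractor :: "'i set \<Rightarrow> ('i \<Rightarrow> 'a \<Rightarrow> 'a) \<Rightarrow> 'a set \<Rightarrow> bool" where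
  "is_attractor I f B \<longleftrightarrow> B \<noteq> {} \<and> compactin mtopology B \<and> B = (\<Union>i\<in>I. f i ` B)"

definition open_set_condition :: "'i set \<Rightarrow> ('i \<Rightarrow> 'a \<Rightarrow> 'a) \<Rightarrow> bool" where
  "open_set_condition I f \<longleftrightarrow>
     (\<exists>V. V \<noteq> {} \<and> mbounded V \<and> openin mtopology V \<and> (\<Union>i\<in>I. f i ` V) \<subseteq> V \<and>
          (\<forall>i\<in>I. \<forall>j\<in>I. i \<noteq> j \<longrightarrow> f i ` V \<inter> f j ` V = {}))"

definition mdiam :: "'a set \<Rightarrow> ennreal" where
  "mdiam U = (SUP x\<in>U. SUP y\<in>U. ennreal (d x y))"

text \<open>\<open>(diam U)\<^sup>s\<close> for \<open>s \<ge> 0\<close> and \<open>U\<close> of finite diameter, with the usual conventions that the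
  empty set contributes \<open>0\<close> and that \<open>0\<^sup>0 = 1\<close> for nonempty \<open>U\<close>.\<close>

definition mdiam_pow :: "real \<Rightarrow> 'a set \<Rightarrow> ennreal" where
  "mdiam_pow s U =
     (if U = {} then 0 else if s = 0 then 1 else ennreal (enn2real (mdiam U) powr s))"

definition hausdorff_premeasure :: "real \<Rightarrow> real \<Rightarrow> 'a set \<Rightarrow> ennreal" where
  "hausdorff_premeasure s \<delta> F =
     Inf {\<Sum>i. mdiam_pow s (U i) | U :: nat \<Rightarrow> 'a set.
            F \<subseteq> (\<Union>i. U i) \<and> (\<forall>i. U i \<subseteq> M \<and> mdiam (U i) \<le> ennreal \<delta>)}"

definition hausdorff_measure :: "real \<Rightarrow> 'a set \<Rightarrow> ennreal" where
  "hausdorff_measure s F = (SUP \<delta>\<in>{0<..}. hausdorff_premeasure s \<delta> F)"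

definition hausdorff_dim :: "'a set \<Rightarrow> ereal" where
  "hausdorff_dim F = Inf {ereal s | s. 0 \<le> s \<and> hausdorff_measure s F = 0}"

definition covering_number :: "real \<Rightarrow> 'a set \<Rightarrow> nat" where
  "covering_number r F =
     (LEAST n. \<exists>C. C \<subseteq> M \<and> finite C \<and> card C = n \<and> F \<subseteq> (\<Union>x\<in>C. mball x r))"

definition upper_box_dim :: "'a set \<Rightarrow> ereal" where
  "upper_box_dim F =
     Limsup (at_right 0) (\<lambda>r. ereal (ln (real (covering_number r F)) / (- ln r)))"

definition lower_box_dim :: "'a set \<Rightarrow> ereal" where
  "lower_box_dim F =
     Liminf (at_right 0) (\<lambda>r. ereal (ln (real (covering_number r F)) / (- ln r)))"

definition has_box_dim :: "'a set \<Rightarrow> ereal \<Rightarrow> bool" where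
  "has_box_dim F b \<longleftrightarrow> upper_box_dim F = b \<and> lower_box_dim F = b"

end

text \<open>\<open>\<real>\<^sup>n\<close> for a varying natural number \<open>n\<close> is \<open>topspace (Euclidean_space n)\<close>: the real sequences
  \<open>x\<close> with \<open>x i = 0\<close> for all \<open>i \<ge> n\<close>.\<close>

abbreviation eucl :: "nat \<Rightarrow> (nat \<Rightarrow> real) set" where
  "eucl n \<equiv> topspace (Euclidean_space n)"

definition eucl_dist :: "nat \<Rightarrow> (nat \<Rightarrow> real) \<Rightarrow> (nat \<Rightarrow> real) \<Rightarrow> real" where
  "eucl_dist n x y = L2_set (\<lambda>i. x i - y i) {..<n}"

definition L2_prod_dist ::
  "'k set \<Rightarrow> ('k \<Rightarrow> 'a \<Rightarrow> 'a \<Rightarrow> real) \<Rightarrow> ('k \<Rightarrow> 'a) \<Rightarrow> ('k \<Rightarrow> 'a) \<Rightarrow> real" where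
  "L2_prod_dist K d x y = L2_set (\<lambda>k. d k (x k) (y k)) K"

definition prod_map ::
  "'k set \<Rightarrow> ('k \<Rightarrow> 'i \<Rightarrow> 'a \<Rightarrow> 'a) \<Rightarrow> ('k \<Rightarrow> 'i) \<Rightarrow> ('k \<Rightarrow> 'a) \<Rightarrow> ('k \<Rightarrow> 'a)" where
  "prod_map K w i x = (\<lambda>k\<in>K. w k (i k) (x k))"

lemma Metric_space_L2_prod:
  assumes "finite K" and "\<And>k. k \<in> K \<Longrightarrow> Metric_space (X k) (d k)"
  shows "Metric_space (Pi\<^sub>E K X) (L2_prod_dist K d)"
proof
  fix x y z
  show "0 \<le> L2_prod_dist K d x y"
    by (simp add: L2_prod_dist_def)
  show "L2_prod_dist K d x y = L2_prod_dist K d y x"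
    unfolding L2_prod_dist_def
    by (rule L2_set_cong) (auto simp: Metric_space.commute[OF assms(2)])
  assume x: "x \<in> Pi\<^sub>E K X" and y: "y \<in> Pi\<^sub>E K X"
  have "d k (x k) (y k) = 0 \<longleftrightarrow> x k = y k" if "k \<in> K" for k
    using Metric_space.zero[OF assms(2)[OF that]] PiE_mem[OF x that] PiE_mem[OF y that] by blast
  then have "L2_prod_dist K d x y = 0 \<longleftrightarrow> (\<forall>k\<in>K. x k = y k)"
    unfolding L2_prod_dist_def by (simp add: L2_set_eq_0_iff assms(1))
  then show "L2_prod_dist K d x y = 0 \<longleftrightarrow> x = y"
    using PiE_ext[OF x y] by auto
  assume z: "z \<in> Pi\<^sub>E K X"
  have "L2_prod_dist K d x z \<le> L2_set (\<lambda>k. d k (x k) (y k) + d k (y k) (z k)) K"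
    unfolding L2_prod_dist_def
  proof (rule L2_set_mono)
    fix k assume k: "k \<in> K"
    interpret Metric_space "X k" "d k" by (rule assms(2)[OF k])
    show "d k (x k) (z k) \<le> d k (x k) (y k) + d k (y k) (z k)"
      using x y z k by (intro triangle) auto
    show "0 \<le> d k (x k) (z k)" by simp
  qed
  also have "\<dots> \<le> L2_prod_dist K d x y + L2_prod_dist K d y z"
    unfolding L2_prod_dist_def by (rule L2_set_triangle_ineq)
  finally show "L2_prod_dist K d x z \<le> L2_prod_dist K d x y + L2_prod_dist K d y z" .
qed

lemma Metric_space_eucl: "Metric_space (eucl n) (eucl_dist n)"
proof
  fix x y z :: "nat \<Rightarrow> real"
  show "0 \<le> eucl_dist n x y"
    by (simp add: eucl_dist_def)
  show "eucl_dist n x y = eucl_dist n y x"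
    by (simp add: eucl_dist_def L2_set_def power2_commute)
  show "eucl_dist n x y = 0 \<longleftrightarrow> x = y" if "x \<in> eucl n" "y \<in> eucl n"
  proof
    assume "eucl_dist n x y = 0"
    then have "\<forall>i<n. x i = y i"
      by (simp add: eucl_dist_def L2_set_eq_0_iff)
    moreover have "\<forall>i\<ge>n. x i = y i"
      using that by (simp add: topspace_Euclidean_space)
    ultimately show "x = y"
      by (metis ext linorder_not_less)
  qed (simp add: eucl_dist_def L2_set_def)
  show "eucl_dist n x z \<le> eucl_dist n x y + eucl_dist n y z"
    using L2_set_triangle_ineq[of "\<lambda>i. x i - y i" "\<lambda>i. y i - z i" "{..<n}"]
    by (simp add: eucl_dist_def)
qed

end

theory Submission
  imports Defs "HOL-Real_Asymp.Real_Asymp" "HOL-Library.Sublist"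
begin

text \<open>The dimension is squeezed between a covering bound from above and a mass bound from below, and both
are compatible with products, so everything reduces to the factors.

From above, a set \<open>F\<close> has \<^emph>\<open>covering exponent\<close> at most \<open>s\<close> if for every \<open>\<epsilon> > 0\<close> it is covered by
\<open>O(r powr -(s + \<epsilon>))\<close> balls of radius \<open>r\<close>. This bounds the upper box dimension and the Hausdorff
dimension. From below, \<open>F\<close> satisfies the \<^emph>\<open>discrete Frostman condition\<close> with exponent \<open>s\<close> if at every
resolution \<open>\<rho>\<close> it carries a finitely supported probability measure giving mass \<open>O(t powr s)\<close> to sets of
diameter at most \<open>t\<close>, for \<open>t \<ge> \<rho>\<close>. By the mass distribution principle, this bounds the lower box dimension
and, for compact \<open>F\<close>, the Hausdorff dimension from below. The two together give \<open>dims_eqI\<close>.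

Products of covers and products of measures show that in both conditions the exponents of the factors
add up. For a single attractor the covering bound follows from self-similarity by
induction on the scale (\<open>covering_exponent_le_attractor\<close>). The Frostman condition is where
the open set condition enters (\<open>discrete_frostman_attractor\<close>): the cylinders of size about \<open>t\<close>
that come near a given set of diameter \<open>t\<close> have separated centres, so their number is bounded, and each
has weight at most \<open>t powr s\<close>. The separation rests on the fact that a similarity of \<open>\<real>\<^sup>n\<close> with positive
ratio is onto.\<close>

section \<open>Bounds for Hausdorff and box dimension\<close>

context Metric_space
begin

text \<open>An upper bound for the growth of covering numbers that is stated by exhibiting covers, so that it
passes to products directly. The loss of an
arbitrary \<open>\<epsilon>\<close> in the exponent leaves the dimension unchanged, and it absorbs the logarithmic
factor that contractions of ratio \<open>0\<close> can cause (for instance when \<open>s = 0\<close> and the set is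
a geometrically converging sequence together with its limit).\<close>
definition covering_exponent_le :: "'a set \<Rightarrow> real \<Rightarrow> bool" where
  "covering_exponent_le F s \<longleftrightarrow>
     (\<forall>\<epsilon>>0. \<exists>C>0. \<forall>r. 0 < r \<and> r < 1 \<longrightarrow>
        (\<exists>E. finite E \<and> E \<subseteq> M \<and> F \<subseteq> (\<Union>x\<in>E. mball x r) \<and> real (card E) \<le> C * r powr - (s + \<epsilon>)))"

text \<open>A discrete substitute for a Frostman measure: instead of one measure of total mass \<open>1\<close> whose value
on sets of diameter \<open>t\<close> is \<open>O(t\<^sup>s)\<close> for all \<open>t\<close>, there is for every resolution \<open>\<rho>\<close> a finitely supported
one (with point masses \<open>p a\<close>) that satisfies the bound for \<open>t \<ge> \<rho>\<close>, with a constant independent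
of \<open>\<rho>\<close>. On a compact set this suffices, because only finitely many sets of a cover matter,
and it avoids any construction of measures.\<close>
definition discrete_frostman :: "'a set \<Rightarrow> real \<Rightarrow> bool" where
  "discrete_frostman F s \<longleftrightarrow>
     (\<exists>C>0. \<forall>\<rho>. 0 < \<rho> \<and> \<rho> < 1 \<longrightarrow>
        (\<exists>A p. finite A \<and> A \<subseteq> F \<and> (\<forall>a\<in>A. 0 \<le> p a) \<and> (\<Sum>a\<in>A. p a) = 1 \<and>
           (\<forall>t U. \<rho> \<le> t \<and> t < 1 \<and> (\<forall>x\<in>U. \<forall>y\<in>U. d x y \<le> t) \<longrightarrow>
              (\<Sum>a\<in>A \<inter> U. p a) \<le> C * t powr s)))"

lemma covering_exponent_leE:
  assumes "covering_exponent_le F s" "0 < \<epsilon>"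
  obtains C where "0 < C" "\<And>r. 0 < r \<Longrightarrow> r < 1 \<Longrightarrow>
    \<exists>E. finite E \<and> E \<subseteq> M \<and> F \<subseteq> (\<Union>x\<in>E. mball x r) \<and> real (card E) \<le> C * r powr - (s + \<epsilon>)"
proof -
  from assms(1)[unfolded covering_exponent_le_def, THEN spec, THEN mp, OF assms(2)]
  obtain C where C: "0 < C" "\<forall>r. 0 < r \<and> r < 1 \<longrightarrow>
    (\<exists>E. finite E \<and> E \<subseteq> M \<and> F \<subseteq> (\<Union>x\<in>E. mball x r) \<and> real (card E) \<le> C * r powr - (s + \<epsilon>))"
    by (elim exE conjE)
  show thesis
    by (rule that[OF C(1)], rule C(2)[THEN spec, THEN mp], rule conjI)
qed

lemma discrete_frostmanE:
  assumes "discrete_frostman F s"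
  obtains C where "0 < C" "\<And>\<rho>. 0 < \<rho> \<Longrightarrow> \<rho> < 1 \<Longrightarrow>
    \<exists>A p. finite A \<and> A \<subseteq> F \<and> (\<forall>a\<in>A. 0 \<le> p a) \<and> (\<Sum>a\<in>A. p a) = 1 \<and>
      (\<forall>t U. \<rho> \<le> t \<and> t < 1 \<and> (\<forall>x\<in>U. \<forall>y\<in>U. d x y \<le> t) \<longrightarrow>
         (\<Sum>a\<in>A \<inter> U. p a) \<le> C * t powr s)"
proof -
  from assms[unfolded discrete_frostman_def]
  obtain C where C: "0 < C" "\<forall>\<rho>. 0 < \<rho> \<and> \<rho> < 1 \<longrightarrow>
    (\<exists>A p. finite A \<and> A \<subseteq> F \<and> (\<forall>a\<in>A. 0 \<le> p a) \<and> (\<Sum>a\<in>A. p a) = 1 \<and>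
      (\<forall>t U. \<rho> \<le> t \<and> t < 1 \<and> (\<forall>x\<in>U. \<forall>y\<in>U. d x y \<le> t) \<longrightarrow>
         (\<Sum>a\<in>A \<inter> U. p a) \<le> C * t powr s))"
    by (elim exE conjE)
  show thesis
    by (rule that[OF C(1)], rule C(2)[THEN spec, THEN mp], rule conjI)
qed

lemma mdiam_le:
  assumes "\<And>x y. x \<in> U \<Longrightarrow> y \<in> U \<Longrightarrow> d x y \<le> t"
  shows "mdiam U \<le> ennreal t"
  unfolding mdiam_def by (intro SUP_least ennreal_leI assms)

lemma dist_le_mdiam:
  assumes "x \<in> U" "y \<in> U" "mdiam U \<le> ennreal t"
  shows "d x y \<le> enn2real (mdiam U)"
proof -
  have "ennreal (d x y) \<le> mdiam U"
    unfolding mdiam_def using assms(1,2) by (meson SUP_upper2 order_refl)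
  moreover have "mdiam U < top"
    using assms(3) by (simp add: order_le_less_trans)
  ultimately have "ennreal (d x y) \<le> ennreal (enn2real (mdiam U))"
    by simp
  then show ?thesis
    by (simp add: ennreal_le_iff)
qed

lemma mdiam_pow_ball_le:
  assumes "0 < s" "0 \<le> r"
  shows "mdiam_pow s (mball x r) \<le> ennreal ((2 * r) powr s)"
proof -
  have "mdiam (mball x r) \<le> ennreal (2 * r)"
  proof (rule mdiam_le)
    fix y z assume "y \<in> mball x r" "z \<in> mball x r"
    then show "d y z \<le> 2 * r"
      using triangle[of y x z] by (auto simp: commute)
  qed
  then have "enn2real (mdiam (mball x r)) \<le> 2 * r"
    using assms by (simp add: enn2real_leI)
  then show ?thesis
    using assms by (auto simp: mdiam_pow_def intro!: ennreal_leI powr_mono2)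
qed

text \<open>A cover by about \<open>r powr -(s + \<epsilon>)\<close> balls of radius \<open>r\<close> costs about \<open>r powr (\<sigma> - s - \<epsilon>)\<close>, which tends
to \<open>0\<close> with \<open>r\<close> as soon as \<open>\<epsilon> < \<sigma> - s\<close>; half of the gap is taken for \<open>\<epsilon>\<close>.\<close>
lemma hausdorff_measure_eq_0:
  assumes "covering_exponent_le F s" "0 \<le> s" "s < \<sigma>"
  shows "hausdorff_measure \<sigma> F = 0"
proof -
  define \<epsilon> where "\<epsilon> = (\<sigma> - s) / 2"
  have "\<epsilon> > 0" using assms by (simp add: \<epsilon>_def)
  with assms(1) obtain C where "C > 0" and C: "\<And>r. 0 < r \<Longrightarrow> r < 1 \<Longrightarrow>
      \<exists>E. finite E \<and> E \<subseteq> M \<and> F \<subseteq> (\<Union>x\<in>E. mball x r) \<and> real (card E) \<le> C * r powr - (s + \<epsilon>)"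
    by (rule covering_exponent_leE) (rule that)
  have le: "hausdorff_premeasure \<sigma> \<delta> F \<le> ennreal e" if "\<delta> > 0" "e > 0" for \<delta> e :: real
  proof -
    have "((\<lambda>r. C * 2 powr \<sigma> * r powr \<epsilon>) \<longlongrightarrow> 0) (at_right 0)"
      using \<open>\<epsilon> > 0\<close> by real_asymp
    then have "\<forall>\<^sub>F r in at_right 0. C * 2 powr \<sigma> * r powr \<epsilon> < e"
      using \<open>e > 0\<close> by (rule order_tendstoD)
    moreover have "\<forall>\<^sub>F r in at_right 0. r < min 1 (\<delta> / 2)"
      using \<open>\<delta> > 0\<close> eventually_at_right_real[of 0 "min 1 (\<delta> / 2)"]
      by (auto elim!: eventually_mono)
    ultimately have "\<forall>\<^sub>F r in at_right (0::real).
        0 < r \<and> r < min 1 (\<delta> / 2) \<and> C * 2 powr \<sigma> * r powr \<epsilon> < e"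
      using eventually_at_right_less[of "0::real"] by eventually_elim auto
    from eventually_happens'[OF trivial_limit_at_right_real this]
    obtain r where r: "0 < r" "r < 1" "2 * r < \<delta>" "C * 2 powr \<sigma> * r powr \<epsilon> < e"
      by auto
    obtain E where E: "finite E" "E \<subseteq> M" "F \<subseteq> (\<Union>x\<in>E. mball x r)"
      and card: "real (card E) \<le> C * r powr - (s + \<epsilon>)"
      using C[OF r(1,2)] by (elim exE conjE)
    obtain h where h: "bij_betw h {0..<card E} E"
      using ex_bij_betw_nat_finite[OF E(1)] by blast
    define U where "U = (\<lambda>i. if i < card E then mball (h i) r else {})"
    have "F \<subseteq> (\<Union>i. U i)"
    proof
      fix x assume "x \<in> F"
      then obtain y where y: "y \<in> E" "x \<in> mball y r" using E(3) by blast
      obtain i where "i \<in> {0..<card E}" "y = h i"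
        using h y(1) by (metis bij_betw_imp_surj_on imageE)
      with y show "x \<in> (\<Union>i. U i)" by (auto simp: U_def intro!: exI[of _ i])
    qed
    moreover have "U i \<subseteq> M \<and> mdiam (U i) \<le> ennreal \<delta>" for i
    proof
      show "U i \<subseteq> M" by (auto simp: U_def)
      show "mdiam (U i) \<le> ennreal \<delta>"
      proof (rule mdiam_le)
        fix y z assume "y \<in> U i" "z \<in> U i"
        then have "y \<in> mball (h i) r" "z \<in> mball (h i) r" by (auto simp: U_def split: if_splits)
        then show "d y z \<le> \<delta>" using triangle[of y "h i" z] r(3) by (auto simp: commute)
      qed
    qed
    ultimately have "hausdorff_premeasure \<sigma> \<delta> F \<le> (\<Sum>i. mdiam_pow \<sigma> (U i))"
      unfolding hausdorff_premeasure_def by (intro Inf_lower) blast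
    also have "\<dots> = (\<Sum>i<card E. mdiam_pow \<sigma> (U i))"
      by (rule suminf_finite) (auto simp: U_def mdiam_pow_def)
    also have "\<dots> \<le> (\<Sum>i<card E. ennreal ((2 * r) powr \<sigma>))"
      using assms(2,3) r(1) by (intro sum_mono) (auto simp: U_def intro!: mdiam_pow_ball_le)
    also have "\<dots> = ennreal (real (card E) * (2 * r) powr \<sigma>)"
      by (simp add: ennreal_mult ennreal_of_nat_eq_real_of_nat)
    also have "\<dots> \<le> ennreal e"
    proof (rule ennreal_leI)
      have "real (card E) * (2 * r) powr \<sigma> \<le> C * r powr - (s + \<epsilon>) * (2 * r) powr \<sigma>"
        using card by (intro mult_right_mono) auto
      also have "\<dots> = C * 2 powr \<sigma> * (r powr - (s + \<epsilon>) * r powr \<sigma>)"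
        using r by (simp add: powr_mult)
      also have "r powr - (s + \<epsilon>) * r powr \<sigma> = r powr \<epsilon>"
        by (simp add: powr_add[symmetric] \<epsilon>_def field_simps)
      finally show "real (card E) * (2 * r) powr \<sigma> \<le> e" using r(4) by simp
    qed
    finally show ?thesis .
  qed
  have "hausdorff_premeasure \<sigma> \<delta> F = 0" if "\<delta> > 0" for \<delta>
  proof -
    have "hausdorff_premeasure \<sigma> \<delta> F \<le> 0"
      by (rule ennreal_le_epsilon) (simp add: le[OF that])
    then show ?thesis by simp
  qed
  then show ?thesis
    unfolding hausdorff_measure_def by (auto intro!: antisym SUP_least)
qed

lemma hausdorff_dim_le:
  assumes "covering_exponent_le F s" "0 \<le> s"
  shows "hausdorff_dim F \<le> ereal s"
proof (rule ereal_le_epsilon2)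
  fix e :: real assume "0 < e"
  then have "hausdorff_measure (s + e) F = 0"
    by (intro hausdorff_measure_eq_0[OF assms]) simp
  then show "hausdorff_dim F \<le> ereal s + ereal e"
    unfolding hausdorff_dim_def using assms(2) \<open>0 < e\<close> by (auto intro!: Inf_lower)
qed

lemma covering_number_le:
  assumes "finite E" "E \<subseteq> M" "F \<subseteq> (\<Union>x\<in>E. mball x r)"
  shows "covering_number r F \<le> card E"
  unfolding covering_number_def
  by (rule Least_le, rule exI[of _ E]) (intro conjI assms refl)

lemma covering_number_attained:
  assumes "finite E" "E \<subseteq> M" "F \<subseteq> (\<Union>x\<in>E. mball x r)"
  obtains E' where "finite E'" "E' \<subseteq> M" "F \<subseteq> (\<Union>x\<in>E'. mball x r)" "card E' = covering_number r F"
proof -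
  have "\<exists>n C. C \<subseteq> M \<and> finite C \<and> card C = n \<and> F \<subseteq> (\<Union>x\<in>C. mball x r)"
    by (intro exI[of _ "card E"] exI[of _ E] conjI assms refl)
  from LeastI_ex[OF this] obtain E' where "E' \<subseteq> M" "finite E'"
    "card E' = covering_number r F" "F \<subseteq> (\<Union>x\<in>E'. mball x r)"
    unfolding covering_number_def[symmetric] by (elim exE conjE)
  then show thesis by (intro that)
qed

lemma upper_box_dim_le:
  assumes "covering_exponent_le F s" "0 \<le> s"
  shows "upper_box_dim F \<le> ereal s"
proof (rule ereal_le_epsilon2)
  fix e :: real assume "0 < e"
  with assms(1) obtain C where "C > 0" and C: "\<And>r. 0 < r \<Longrightarrow> r < 1 \<Longrightarrow>
      \<exists>E. finite E \<and> E \<subseteq> M \<and> F \<subseteq> (\<Union>x\<in>E. mball x r) \<and> real (card E) \<le> C * r powr - (s + e)"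
    by (rule covering_exponent_leE) (rule that)
  \<comment> \<open>a constant at least 1 also covers the empty set, where \<open>ln 0 = 0\<close>\<close>
  define C' where "C' = max C 1"
  have bound: "ln (real (covering_number r F)) / (- ln r) \<le> (ln C' - (s + e) * ln r) / (- ln r)"
    if r: "0 < r" "r < 1" for r
  proof -
    obtain E where E: "finite E" "E \<subseteq> M" "F \<subseteq> (\<Union>x\<in>E. mball x r)"
      and card: "real (card E) \<le> C * r powr - (s + e)"
      using C[OF r] by (elim exE conjE)
    have "real (covering_number r F) \<le> C * r powr - (s + e)"
      using covering_number_le[OF E] card by linarith
    also have "\<dots> \<le> C' * r powr - (s + e)"
      by (intro mult_right_mono) (auto simp: C'_def)
    finally have le: "real (covering_number r F) \<le> C' * r powr - (s + e)" .
    have "ln (real (covering_number r F)) \<le> ln (C' * r powr - (s + e))"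
    proof (cases "covering_number r F = 0")
      case True
      have "1 \<le> C' * r powr - (s + e)"
      proof -
        have "1 \<le> r powr - (s + e)"
          using powr_mono2'[of "- (s + e)" r 1] r assms(2) \<open>0 < e\<close> by simp
        then show ?thesis
          using mult_mono[of 1 C' 1 "r powr - (s + e)"] by (simp add: C'_def)
      qed
      then show ?thesis using True by simp
    next
      case False
      then show ?thesis using le by (simp add: ln_mono)
    qed
    also have "\<dots> = ln C' - (s + e) * ln r"
      using r by (subst ln_mult) (auto simp: C'_def ln_powr algebra_simps)
    finally show ?thesis
      using r by (intro divide_right_mono) (auto simp: ln_le_zero_iff)
  qed
  have "upper_box_dim F \<le> Limsup (at_right 0) (\<lambda>r. ereal ((ln C' - (s + e) * ln r) / (- ln r)))"
    unfolding upper_box_dim_def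
  proof (rule Limsup_mono)
    show "\<forall>\<^sub>F r in at_right 0. ereal (ln (real (covering_number r F)) / - ln r)
            \<le> ereal ((ln C' - (s + e) * ln r) / - ln r)"
      using eventually_at_right_real[of 0 1] by (rule eventually_mono) (use bound in auto)
  qed
  also have "\<dots> = ereal (s + e)"
  proof (rule lim_imp_Limsup)
    have "((\<lambda>r. (ln C' - (s + e) * ln r) / (- ln r)) \<longlongrightarrow> s + e) (at_right 0)"
      by real_asymp
    then show "((\<lambda>r. ereal ((ln C' - (s + e) * ln r) / (- ln r))) \<longlongrightarrow> ereal (s + e)) (at_right 0)"
      by (rule tendsto_ereal)
  qed (simp add: trivial_limit_at_right_real)
  finally show "upper_box_dim F \<le> ereal s + ereal e" by simp
qed

lemma frostman_cover_sum:
  assumes "finite J" "F \<subseteq> (\<Union>j\<in>J. V j)" "finite A" "A \<subseteq> F" "\<forall>a\<in>A. 0 \<le> p a" "(\<Sum>a\<in>A. p a) = 1"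
    and "\<And>j. j \<in> J \<Longrightarrow> (\<Sum>a\<in>A \<inter> V j. p a) \<le> b j"
  shows "1 \<le> (\<Sum>j\<in>J. b j :: real)"
proof -
  have "1 = (\<Sum>a\<in>A. p a)" using assms by simp
  also have "\<dots> \<le> (\<Sum>a\<in>(\<Union>j\<in>J. A \<inter> V j). p a)"
    using assms by (intro sum_mono2) auto
  also have "\<dots> \<le> (\<Sum>j\<in>J. \<Sum>a\<in>A \<inter> V j. p a)"
    using assms(1,3,5)
  proof (induction J rule: finite_induct)
    case (insert j J)
    have "(\<Sum>a\<in>(\<Union>i\<in>insert j J. A \<inter> V i). p a) \<le>
        (\<Sum>a\<in>A \<inter> V j. p a) + (\<Sum>a\<in>(\<Union>i\<in>J. A \<inter> V i). p a)"
      using insert.prems insert.hyps(1)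
        sum.union_inter[of "A \<inter> V j" "\<Union>i\<in>J. A \<inter> V i" p]
        sum_nonneg[of "(A \<inter> V j) \<inter> (\<Union>i\<in>J. A \<inter> V i)" p] by simp
    then show ?case using insert.IH insert.prems insert.hyps by simp
  qed simp
  also have "\<dots> \<le> (\<Sum>j\<in>J. b j)"
    using assms(7) by (rule sum_mono)
  finally show ?thesis .
qed

text \<open>The mass distribution principle. The sets of a countable cover are fattened to open sets by amounts
so small that the fattening adds at most \<open>1/2\<close> to the mass bound; compactness leaves finitely many of
them, so there is a resolution \<open>\<rho>\<close> below all their diameters, and the discrete mass at that
resolution must be exhausted by the cover. The mass bound has exponent \<open>s\<close>; since the diameters are
below \<open>1\<close>, it may be weakened to any exponent \<open>\<sigma> \<le> s\<close>.\<close>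
lemma hausdorff_premeasure_pos:
  assumes F: "compactin mtopology F" and fr: "discrete_frostman F s" and s: "0 < s" "0 \<le> \<sigma>" "\<sigma> \<le> s"
  shows "0 < hausdorff_premeasure \<sigma> (1/4) F"
proof -
  from fr obtain C where "C > 0" and C: "\<And>\<rho>. 0 < \<rho> \<Longrightarrow> \<rho> < 1 \<Longrightarrow>
        \<exists>A p. finite A \<and> A \<subseteq> F \<and> (\<forall>a\<in>A. 0 \<le> p a) \<and> (\<Sum>a\<in>A. p a) = 1 \<and>
           (\<forall>t U. \<rho> \<le> t \<and> t < 1 \<and> (\<forall>x\<in>U. \<forall>y\<in>U. d x y \<le> t) \<longrightarrow>
              (\<Sum>a\<in>A \<inter> U. p a) \<le> C * t powr s)"
    by (rule discrete_frostmanE) (rule that)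
  define \<tau> where "\<tau> = min (1 / (2 * C * 2 powr s)) ((1/4) powr s)"
  have \<tau>: "0 < \<tau>" "\<tau> \<le> (1/4) powr s" "C * 2 powr s * \<tau> \<le> 1 / 2"
  proof -
    show "0 < \<tau>" "\<tau> \<le> (1/4) powr s" using \<open>C > 0\<close> by (auto simp: \<tau>_def)
    have "C * 2 powr s * \<tau> \<le> C * 2 powr s * (1 / (2 * C * 2 powr s))"
      using \<open>C > 0\<close> by (intro mult_left_mono) (auto simp: \<tau>_def)
    then show "C * 2 powr s * \<tau> \<le> 1 / 2" using \<open>C > 0\<close> by simp
  qed
  \<comment> \<open>chosen such that the \<open>s\<close>-th powers of the fattening widths sum to \<open>\<tau>\<close>\<close>
  define e where "e = (\<lambda>i::nat. (\<tau> * (1/2) ^ Suc i) powr (1 / s))"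
  have e_pos: "0 < e i" for i using \<tau>(1) by (simp add: e_def)
  have e_powr: "e i powr s = \<tau> * (1/2) ^ Suc i" for i
    using \<tau>(1) s(1) by (simp add: e_def powr_powr)
  have e_le: "e i \<le> 1/4" for i
  proof -
    have "\<tau> * (1/2) ^ Suc i \<le> \<tau> * 1"
      using \<tau>(1) by (intro mult_left_mono power_le_one) auto
    then have "\<tau> * (1/2) ^ Suc i \<le> (1/4) powr s"
      using \<tau>(2) by linarith
    then have "e i \<le> ((1/4) powr s) powr (1 / s)"
      unfolding e_def using \<tau>(1) s(1) by (intro powr_mono2) simp_all
    then show ?thesis using s(1) by (simp add: powr_powr)
  qed
  have "ennreal (1 / (2 * C * 2 powr s)) \<le> hausdorff_premeasure \<sigma> (1/4) F"
    unfolding hausdorff_premeasure_def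
  proof (rule Inf_greatest, clarify)
    fix U :: "nat \<Rightarrow> 'a set"
    assume cov: "F \<subseteq> (\<Union>i. U i)" and U: "\<forall>i. U i \<subseteq> M \<and> mdiam (U i) \<le> ennreal (1/4)"
    define dm where "dm = (\<lambda>i. enn2real (mdiam (U i)))"
    have dm: "0 \<le> dm i" "dm i \<le> 1/4" for i
    proof -
      have "mdiam (U i) \<le> ennreal (1/4)" using U by blast
      then show "dm i \<le> 1/4" unfolding dm_def by (rule enn2real_leI[rotated]) simp
      show "0 \<le> dm i" by (simp add: dm_def)
    qed
    define V where "V = (\<lambda>i. \<Union>x\<in>U i. mball x (e i / 2))"
    have "\<exists>J. finite J \<and> J \<subseteq> range V \<and> F \<subseteq> \<Union>J"
    proof -
      have "\<And>v. v \<in> range V \<Longrightarrow> openin mtopology v"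
        by (auto simp: V_def)
      moreover have "F \<subseteq> \<Union>(range V)"
      proof
        fix x assume "x \<in> F"
        then obtain i where "x \<in> U i" using cov by blast
        moreover have "x \<in> M" using U \<open>x \<in> U i\<close> by blast
        ultimately show "x \<in> \<Union>(range V)" using e_pos[of i] by (auto simp: V_def intro!: bexI[of _ x])
      qed
      ultimately show ?thesis using F unfolding compactin_def by auto
    qed
    then obtain J0 where J0: "finite J0" "F \<subseteq> (\<Union>j\<in>J0. V j)"
      by (metis finite_subset_image)
    define J where "J = {j\<in>J0. U j \<noteq> {}}"
    have J: "finite J" "F \<subseteq> (\<Union>j\<in>J. V j)"
    proof -
      show "finite J" using J0(1) by (simp add: J_def)
      have "V j = {}" if "U j = {}" for j using that by (simp add: V_def)
      then show "F \<subseteq> (\<Union>j\<in>J. V j)" using J0(2) by (fastforce simp: J_def)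
    qed
    define \<rho> where "\<rho> = Min (insert (1/2) ((\<lambda>j. dm j + e j) ` J))"
    have \<rho>: "0 < \<rho>" "\<rho> < 1" "\<And>j. j \<in> J \<Longrightarrow> \<rho> \<le> dm j + e j"
    proof -
      show "0 < \<rho>" unfolding \<rho>_def using J(1) e_pos dm by (auto simp: add_nonneg_pos)
      have "\<rho> \<le> 1/2" unfolding \<rho>_def using J(1) by (intro Min_le) auto
      then show "\<rho> < 1" by simp
      show "\<rho> \<le> dm j + e j" if "j \<in> J" for j
        unfolding \<rho>_def using J(1) that by (intro Min_le) auto
    qed
    obtain A p where Ap: "finite A" "A \<subseteq> F" "\<forall>a\<in>A. 0 \<le> p a" "(\<Sum>a\<in>A. p a) = 1"
      and bound: "\<forall>t U. \<rho> \<le> t \<and> t < 1 \<and> (\<forall>x\<in>U. \<forall>y\<in>U. d x y \<le> t) \<longrightarrow>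
              (\<Sum>a\<in>A \<inter> U. p a) \<le> C * t powr s"
      using C[OF \<rho>(1,2)] by (elim exE conjE)
    have "1 \<le> (\<Sum>j\<in>J. C * (dm j + e j) powr s)"
    proof (rule frostman_cover_sum[OF J Ap])
      fix j assume "j \<in> J"
      show "(\<Sum>a\<in>A \<inter> V j. p a) \<le> C * (dm j + e j) powr s"
      proof (rule bound[rule_format], intro conjI)
        show "\<rho> \<le> dm j + e j" using \<rho>(3)[OF \<open>j \<in> J\<close>] .
        show "dm j + e j < 1" using dm(2)[of j] e_le[of j] by simp
        show "\<forall>x\<in>V j. \<forall>y\<in>V j. d x y \<le> dm j + e j"
        proof (intro ballI)
          fix x y assume "x \<in> V j" "y \<in> V j"
          then obtain x' y' where x': "x' \<in> U j" "x \<in> mball x' (e j / 2)"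
            and y': "y' \<in> U j" "y \<in> mball y' (e j / 2)"
            by (auto simp: V_def)
          have "d x' y' \<le> dm j"
            unfolding dm_def using x' y' U by (intro dist_le_mdiam) auto
          moreover have "d x y \<le> d x x' + d x' y" "d x' y \<le> d x' y' + d y' y"
            using x' y' by (auto intro!: triangle)
          moreover have "d x x' < e j / 2" "d y' y < e j / 2"
            using x' y' by (auto simp: commute)
          ultimately show "d x y \<le> dm j + e j" by linarith
        qed
      qed
    qed
    also have "\<dots> \<le> (\<Sum>j\<in>J. C * 2 powr s * (dm j powr \<sigma> + \<tau> * (1/2) ^ Suc j))"
    proof (rule sum_mono)
      fix j
      have "(dm j + e j) powr s \<le> (2 * max (dm j) (e j)) powr s"
        using dm(1)[of j] e_pos[of j] s(1) by (intro powr_mono2) auto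
      also have "\<dots> = 2 powr s * max (dm j) (e j) powr s"
        using dm(1)[of j] by (intro powr_mult) 
      also have "max (dm j) (e j) powr s \<le> dm j powr s + e j powr s"
        by (simp add: max_def)
      also have "dm j powr s \<le> dm j powr \<sigma>"
        using dm[of j] s by (intro powr_mono') auto
      finally show "C * (dm j + e j) powr s \<le> C * 2 powr s * (dm j powr \<sigma> + \<tau> * (1/2) ^ Suc j)"
        using \<open>C > 0\<close> by (simp add: e_powr mult.assoc)
    qed
    also have "\<dots> = C * 2 powr s * (\<Sum>j\<in>J. dm j powr \<sigma>) + C * 2 powr s * (\<tau> * (\<Sum>j\<in>J. (1/2) ^ Suc j))"
      by (simp add: sum_distrib_left sum.distrib distrib_left)
    also have "\<dots> \<le> C * 2 powr s * (\<Sum>j\<in>J. dm j powr \<sigma>) + 1 / 2"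
    proof -
      have "(\<Sum>j\<in>J. (1/2::real) ^ Suc j) \<le> 1"
        using sum_le_suminf[OF _ J(1), of "\<lambda>j. (1/2::real) ^ Suc j"] power_half_series
        by (auto simp: sums_iff)
      then have "\<tau> * (\<Sum>j\<in>J. (1/2::real) ^ Suc j) \<le> \<tau>"
        using \<tau>(1) by (simp add: mult_left_le)
      then have "C * 2 powr s * (\<tau> * (\<Sum>j\<in>J. (1/2) ^ Suc j)) \<le> C * 2 powr s * \<tau>"
        using \<open>C > 0\<close> by (intro mult_left_mono) auto
      then show ?thesis using \<tau>(3) by simp
    qed
    finally have "1 / (2 * C * 2 powr s) \<le> (\<Sum>j\<in>J. dm j powr \<sigma>)"
      using \<open>C > 0\<close> by (simp add: field_simps)
    then have "ennreal (1 / (2 * C * 2 powr s)) \<le> ennreal (\<Sum>j\<in>J. dm j powr \<sigma>)"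
      by (rule ennreal_leI)
    also have "\<dots> = (\<Sum>j\<in>J. ennreal (dm j powr \<sigma>))"
      by (subst sum_ennreal) auto
    also have "\<dots> \<le> (\<Sum>j\<in>J. mdiam_pow \<sigma> (U j))"
    proof (rule sum_mono)
      fix j assume "j \<in> J"
      then show "ennreal (dm j powr \<sigma>) \<le> mdiam_pow \<sigma> (U j)"
        by (auto simp: J_def mdiam_pow_def dm_def)
    qed
    also have "\<dots> \<le> (\<Sum>i. mdiam_pow \<sigma> (U i))"
      using J(1) by (intro sum_le_suminf) auto
    finally show "ennreal (1 / (2 * C * 2 powr s)) \<le> (\<Sum>i. mdiam_pow \<sigma> (U i))" .
  qed
  moreover have "0 < ennreal (1 / (2 * C * 2 powr s))" using \<open>C > 0\<close> by simp
  ultimately show ?thesis by (rule order_less_le_trans[rotated])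
qed

lemma hausdorff_dim_ge:
  assumes F: "compactin mtopology F" and fr: "discrete_frostman F s" and s: "0 \<le> s"
  shows "ereal s \<le> hausdorff_dim F"
  unfolding hausdorff_dim_def
proof (rule Inf_greatest, clarify)
  fix \<sigma> :: real
  assume \<sigma>: "0 \<le> \<sigma>" "hausdorff_measure \<sigma> F = 0"
  have "s \<le> \<sigma>"
  proof (rule ccontr)
    assume "\<not> s \<le> \<sigma>"
    then have "0 < hausdorff_premeasure \<sigma> (1/4) F"
      using \<sigma>(1) by (intro hausdorff_premeasure_pos[OF F fr]) auto
    also have "\<dots> \<le> hausdorff_measure \<sigma> F"
      unfolding hausdorff_measure_def by (rule SUP_upper) simp
    finally show False using \<sigma>(2) by simp
  qed
  then show "ereal s \<le> ereal \<sigma>" by simp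
qed

text \<open>Each ball of radius \<open>r\<close> carries mass \<open>O(r\<^sup>s)\<close>, so covering the total mass \<open>1\<close> takes at least a constant
times \<open>r powr -s\<close> of them. The covering exponent serves to guarantee that finite covers exist, without
which the covering number would be meaningless.\<close>
lemma lower_box_dim_ge:
  assumes cov: "covering_exponent_le F s'" and fr: "discrete_frostman F s"
  shows "ereal s \<le> lower_box_dim F"
proof -
  from fr obtain C where "C > 0" and C: "\<And>\<rho>. 0 < \<rho> \<Longrightarrow> \<rho> < 1 \<Longrightarrow>
        \<exists>A p. finite A \<and> A \<subseteq> F \<and> (\<forall>a\<in>A. 0 \<le> p a) \<and> (\<Sum>a\<in>A. p a) = 1 \<and>
           (\<forall>t U. \<rho> \<le> t \<and> t < 1 \<and> (\<forall>x\<in>U. \<forall>y\<in>U. d x y \<le> t) \<longrightarrow>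
              (\<Sum>a\<in>A \<inter> U. p a) \<le> C * t powr s)"
    by (rule discrete_frostmanE) (rule that)
  obtain C0 where cov0: "\<And>r. 0 < r \<Longrightarrow> r < 1 \<Longrightarrow> \<exists>E. finite E \<and> E \<subseteq> M \<and>
      F \<subseteq> (\<Union>x\<in>E. mball x r) \<and> real (card E) \<le> C0 * r powr - (s' + 1)"
    using cov zero_less_one by (rule covering_exponent_leE) (rule that)
  define b where "b = - ln (C * 2 powr s)"
  have bound: "(b - s * ln r) / (- ln r) \<le> ln (real (covering_number r F)) / (- ln r)"
    if r: "0 < r" "r < 1/2" for r
  proof -
    obtain E0 where "finite E0" "E0 \<subseteq> M" "F \<subseteq> (\<Union>x\<in>E0. mball x r)"
      using cov0[of r] r by auto
    then obtain E where E: "finite E" "E \<subseteq> M" "F \<subseteq> (\<Union>x\<in>E. mball x r)"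
      and card: "card E = covering_number r F"
      by (rule covering_number_attained) (rule that)
    have r2: "0 < 2 * r" "2 * r < 1" using r by auto
    obtain A p where Ap: "finite A" "A \<subseteq> F" "\<forall>a\<in>A. 0 \<le> p a" "(\<Sum>a\<in>A. p a) = 1"
      and bd: "\<forall>t U. 2 * r \<le> t \<and> t < 1 \<and> (\<forall>x\<in>U. \<forall>y\<in>U. d x y \<le> t) \<longrightarrow>
              (\<Sum>a\<in>A \<inter> U. p a) \<le> C * t powr s"
      using C[OF r2] by (elim exE conjE)
    have "1 \<le> (\<Sum>x\<in>E. C * (2 * r) powr s)"
    proof (rule frostman_cover_sum[OF E(1,3) Ap])
      fix x
      show "(\<Sum>a\<in>A \<inter> mball x r. p a) \<le> C * (2 * r) powr s"
      proof (rule bd[rule_format], intro conjI ballI, simp, use r in simp)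
        fix y z assume "y \<in> mball x r" "z \<in> mball x r"
        then show "d y z \<le> 2 * r"
          using triangle[of y x z] by (auto simp: commute)
      qed
    qed
    then have le: "1 \<le> real (covering_number r F) * (C * (2 * r) powr s)"
      by (simp add: card)
    then have N: "0 < real (covering_number r F)"
      by (cases "covering_number r F = 0") auto
    have "0 \<le> ln (real (covering_number r F) * (C * (2 * r) powr s))"
      using le by simp
    also have "\<dots> = ln (real (covering_number r F)) + (ln (C * 2 powr s) + s * ln r)"
      using N r \<open>C > 0\<close> by (simp add: ln_mult powr_mult ln_powr)
    finally have "b - s * ln r \<le> ln (real (covering_number r F))"
      by (simp add: b_def)
    then show ?thesis using r by (intro divide_right_mono) (auto simp: ln_le_zero_iff)
  qed
  have "ereal s = Liminf (at_right 0) (\<lambda>r. ereal ((b - s * ln r) / (- ln r)))"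
  proof (rule lim_imp_Liminf[symmetric])
    have "((\<lambda>r. (b - s * ln r) / (- ln r)) \<longlongrightarrow> s) (at_right 0)"
      by real_asymp
    then show "((\<lambda>r. ereal ((b - s * ln r) / (- ln r))) \<longlongrightarrow> ereal s) (at_right 0)"
      by (rule tendsto_ereal)
  qed (simp add: trivial_limit_at_right_real)
  also have "\<dots> \<le> lower_box_dim F"
    unfolding lower_box_dim_def
  proof (rule Liminf_mono)
    show "\<forall>\<^sub>F r in at_right 0. ereal ((b - s * ln r) / - ln r)
            \<le> ereal (ln (real (covering_number r F)) / - ln r)"
      using eventually_at_right_real[of 0 "1/2"] by (rule eventually_mono) (use bound in auto)
  qed
  finally show ?thesis .
qed

lemma dims_eqI:
  assumes "compactin mtopology F" "0 \<le> s" "covering_exponent_le F s" "discrete_frostman F s"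
  shows "hausdorff_dim F = ereal s \<and> has_box_dim F (ereal s)"
proof
  show "hausdorff_dim F = ereal s"
    using hausdorff_dim_le hausdorff_dim_ge assms by (intro antisym) auto
  have "lower_box_dim F \<le> upper_box_dim F"
    unfolding lower_box_dim_def upper_box_dim_def
    by (rule Liminf_le_Limsup) (simp add: trivial_limit_at_right_real)
  moreover have "upper_box_dim F \<le> ereal s" "ereal s \<le> lower_box_dim F"
    using upper_box_dim_le lower_box_dim_ge assms by auto
  ultimately show "has_box_dim F (ereal s)"
    unfolding has_box_dim_def by auto
qed

end

section \<open>Products\<close>

text \<open>Products of balls of radius \<open>r / q\<close>, where \<open>q\<close> is the number of factors, lie in balls of radius \<open>r\<close>
because the Euclidean norm is bounded by the sum of the components. The \<open>\<epsilon>\<close> of the definition is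
divided equally among the factors.\<close>
lemma covering_exponent_le_L2_prod:
  assumes K: "finite K" "K \<noteq> {}" and X: "\<And>k. k \<in> K \<Longrightarrow> Metric_space (X k) (d k)"
    and G: "\<And>k. k \<in> K \<Longrightarrow> Metric_space.covering_exponent_le (X k) (d k) (G k) (s k)"
  shows "Metric_space.covering_exponent_le (Pi\<^sub>E K X) (L2_prod_dist K d) (Pi\<^sub>E K G) (\<Sum>k\<in>K. s k)"
proof -
  interpret P: Metric_space "Pi\<^sub>E K X" "L2_prod_dist K d"
    by (rule Metric_space_L2_prod[OF K(1) X])
  define q where "q = real (card K)"
  have q: "1 \<le> q" using K by (simp add: q_def Suc_le_eq card_gt_0_iff)
  show ?thesis
    unfolding P.covering_exponent_le_def
  proof (intro allI impI)
    fix \<epsilon> :: real assume "0 < \<epsilon>"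
    then have "0 < \<epsilon> / q" using q by simp
    then have "\<forall>k\<in>K. \<exists>C>0. \<forall>r. 0 < r \<and> r < 1 \<longrightarrow> (\<exists>E. finite E \<and> E \<subseteq> X k \<and>
        G k \<subseteq> (\<Union>x\<in>E. Metric_space.mball (X k) (d k) x r) \<and>
        real (card E) \<le> C * r powr - (s k + \<epsilon> / q))"
      using G by (auto simp: Metric_space.covering_exponent_le_def[OF X])
    from bchoice[OF this] obtain C where C': "\<forall>k\<in>K. 0 < C k \<and> (\<forall>r. 0 < r \<and> r < 1 \<longrightarrow> (\<exists>E. finite E \<and> E \<subseteq> X k \<and>
        G k \<subseteq> (\<Union>x\<in>E. Metric_space.mball (X k) (d k) x r) \<and>
        real (card E) \<le> C k * r powr - (s k + \<epsilon> / q)))"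
      by (elim exE)
    have C: "\<And>k. k \<in> K \<Longrightarrow> 0 < C k"
      and ex: "\<And>k r. k \<in> K \<Longrightarrow> 0 < r \<Longrightarrow> r < 1 \<Longrightarrow> \<exists>E. finite E \<and> E \<subseteq> X k \<and>
        G k \<subseteq> (\<Union>x\<in>E. Metric_space.mball (X k) (d k) x r) \<and>
        real (card E) \<le> C k * r powr - (s k + \<epsilon> / q)"
      using C' by simp_all
    define \<sigma> where "\<sigma> = (\<Sum>k\<in>K. s k) + \<epsilon>"
    have \<sigma>: "(\<Sum>k\<in>K. s k + \<epsilon> / q) = \<sigma>"
      using q by (simp add: sum.distrib \<sigma>_def q_def)
    show "\<exists>C>0. \<forall>r. 0 < r \<and> r < 1 \<longrightarrow> (\<exists>E. finite E \<and> E \<subseteq> Pi\<^sub>E K X \<and>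
        Pi\<^sub>E K G \<subseteq> (\<Union>x\<in>E. P.mball x r) \<and> real (card E) \<le> C * r powr - ((\<Sum>k\<in>K. s k) + \<epsilon>))"
    proof (intro exI[of _ "(\<Prod>k\<in>K. C k) * q powr \<sigma>"] conjI allI impI)
      show "0 < (\<Prod>k\<in>K. C k) * q powr \<sigma>"
        using C q by (simp add: prod_pos)
      fix r :: real assume r: "0 < r \<and> r < 1"
      define r' where "r' = r / q"
      have r': "0 < r'" "r' < 1" using r q by (auto simp: r'_def divide_less_eq)
      have "\<forall>k\<in>K. \<exists>E. finite E \<and> E \<subseteq> X k \<and>
          G k \<subseteq> (\<Union>x\<in>E. Metric_space.mball (X k) (d k) x r') \<and>
          real (card E) \<le> C k * r' powr - (s k + \<epsilon> / q)"
        using ex[OF _ r'] by (rule ballI)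
      from bchoice[OF this] obtain E where E': "\<forall>k\<in>K. finite (E k) \<and> E k \<subseteq> X k \<and>
          G k \<subseteq> (\<Union>x\<in>E k. Metric_space.mball (X k) (d k) x r') \<and>
          real (card (E k)) \<le> C k * r' powr - (s k + \<epsilon> / q)"
        by (elim exE)
      have E: "\<And>k. k \<in> K \<Longrightarrow> finite (E k)" "\<And>k. k \<in> K \<Longrightarrow> E k \<subseteq> X k"
        "\<And>k. k \<in> K \<Longrightarrow> G k \<subseteq> (\<Union>x\<in>E k. Metric_space.mball (X k) (d k) x r')"
        "\<And>k. k \<in> K \<Longrightarrow> real (card (E k)) \<le> C k * r' powr - (s k + \<epsilon> / q)"
        using E' by simp_all
      show "\<exists>E. finite E \<and> E \<subseteq> Pi\<^sub>E K X \<and> Pi\<^sub>E K G \<subseteq> (\<Union>x\<in>E. P.mball x r) \<and>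
          real (card E) \<le> (\<Prod>k\<in>K. C k) * q powr \<sigma> * r powr - ((\<Sum>k\<in>K. s k) + \<epsilon>)"
      proof (intro exI[of _ "Pi\<^sub>E K E"] conjI)
        show "finite (Pi\<^sub>E K E)" using K E by (intro finite_PiE) auto
        show "Pi\<^sub>E K E \<subseteq> Pi\<^sub>E K X" using E(2) by (rule PiE_mono)
        show "Pi\<^sub>E K G \<subseteq> (\<Union>x\<in>Pi\<^sub>E K E. P.mball x r)"
        proof
          fix y assume y: "y \<in> Pi\<^sub>E K G"
          have "\<forall>k\<in>K. \<exists>x. x \<in> E k \<and> y k \<in> X k \<and> d k x (y k) < r'"
          proof
            fix k assume k: "k \<in> K"
            interpret Metric_space "X k" "d k" by (rule X[OF k])
            have "y k \<in> (\<Union>x\<in>E k. mball x r')"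
              using E(3)[OF k] PiE_mem[OF y k] by (rule subsetD)
            then show "\<exists>x. x \<in> E k \<and> y k \<in> X k \<and> d k x (y k) < r'"
              by auto
          qed
          from bchoice[OF this]
          obtain x where x: "\<And>k. k \<in> K \<Longrightarrow> x k \<in> E k \<and> y k \<in> X k \<and> d k (x k) (y k) < r'"
            by auto
          have xX: "restrict x K \<in> Pi\<^sub>E K X" and yX: "y \<in> Pi\<^sub>E K X"
            using x E(2) y by (auto simp: PiE_iff)
          have "L2_prod_dist K d (restrict x K) y \<le> (\<Sum>k\<in>K. \<bar>d k (restrict x K k) (y k)\<bar>)"
            unfolding L2_prod_dist_def by (rule L2_set_le_sum_abs)
          also have "\<dots> < (\<Sum>k\<in>K. r')"
          proof (rule sum_strict_mono[OF K])
            fix k assume k: "k \<in> K"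
            interpret Metric_space "X k" "d k" by (rule X[OF k])
            show "\<bar>d k (restrict x K k) (y k)\<bar> < r'" using x[OF k] k by simp
          qed
          also have "\<dots> = r" using q by (simp add: r'_def q_def)
          finally have "y \<in> P.mball (restrict x K) r" using xX yX by simp
          moreover have "restrict x K \<in> Pi\<^sub>E K E" using x by simp
          ultimately show "y \<in> (\<Union>x\<in>Pi\<^sub>E K E. P.mball x r)" by blast
        qed
        have "real (card (Pi\<^sub>E K E)) = (\<Prod>k\<in>K. real (card (E k)))"
          using K(1) by (simp add: card_PiE)
        also have "\<dots> \<le> (\<Prod>k\<in>K. C k * r' powr - (s k + \<epsilon> / q))"
          using E(4) by (intro prod_mono) auto
        also have "\<dots> = (\<Prod>k\<in>K. C k) * r' powr (\<Sum>k\<in>K. - (s k + \<epsilon> / q))"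
          using r' by (simp add: prod.distrib powr_sum)
        also have "(\<Sum>k\<in>K. - (s k + \<epsilon> / q)) = - \<sigma>"
          by (simp only: sum_negf \<sigma>)
        also have "r' powr - \<sigma> = q powr \<sigma> * r powr - \<sigma>"
          using q r by (simp add: r'_def powr_divide powr_minus field_simps)
        finally show "real (card (Pi\<^sub>E K E)) \<le> (\<Prod>k\<in>K. C k) * q powr \<sigma> * r powr - ((\<Sum>k\<in>K. s k) + \<epsilon>)"
          by (simp add: \<sigma>_def mult.assoc)
      qed
    qed
  qed
qed

text \<open>The product of the discrete measures works: a set of diameter at most \<open>t\<close> lies in the box spanned by its
projections, whose diameters are at most \<open>t\<close> too, and the mass of a box is a product.\<close>
lemma discrete_frostman_L2_prod:
  assumes K: "finite K" and X: "\<And>k. k \<in> K \<Longrightarrow> Metric_space (X k) (d k)"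
    and GX: "\<And>k. k \<in> K \<Longrightarrow> G k \<subseteq> X k"
    and G: "\<And>k. k \<in> K \<Longrightarrow> Metric_space.discrete_frostman (d k) (G k) (s k)"
  shows "Metric_space.discrete_frostman (L2_prod_dist K d) (Pi\<^sub>E K G) (\<Sum>k\<in>K. s k)"
proof -
  interpret P: Metric_space "Pi\<^sub>E K X" "L2_prod_dist K d"
    by (rule Metric_space_L2_prod[OF K X])
  have "\<forall>k\<in>K. \<exists>C>0. \<forall>\<rho>. 0 < \<rho> \<and> \<rho> < 1 \<longrightarrow>
        (\<exists>A p. finite A \<and> A \<subseteq> G k \<and> (\<forall>a\<in>A. 0 \<le> p a) \<and> (\<Sum>a\<in>A. p a) = 1 \<and>
           (\<forall>t U. \<rho> \<le> t \<and> t < 1 \<and> (\<forall>x\<in>U. \<forall>y\<in>U. d k x y \<le> t) \<longrightarrow>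
              (\<Sum>a\<in>A \<inter> U. p a) \<le> C * t powr s k))"
    using G by (simp add: Metric_space.discrete_frostman_def[OF X])
  from bchoice[OF this] obtain C where C': "\<forall>k\<in>K. 0 < C k \<and> (\<forall>\<rho>. 0 < \<rho> \<and> \<rho> < 1 \<longrightarrow>
        (\<exists>A p. finite A \<and> A \<subseteq> G k \<and> (\<forall>a\<in>A. 0 \<le> p a) \<and> (\<Sum>a\<in>A. p a) = 1 \<and>
           (\<forall>t U. \<rho> \<le> t \<and> t < 1 \<and> (\<forall>x\<in>U. \<forall>y\<in>U. d k x y \<le> t) \<longrightarrow>
              (\<Sum>a\<in>A \<inter> U. p a) \<le> C k * t powr s k)))"
    by (elim exE)
  have C: "\<And>k. k \<in> K \<Longrightarrow> 0 < C k"
    and ex: "\<And>k \<rho>. k \<in> K \<Longrightarrow> 0 < \<rho> \<Longrightarrow> \<rho> < 1 \<Longrightarrow>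
        \<exists>A p. finite A \<and> A \<subseteq> G k \<and> (\<forall>a\<in>A. 0 \<le> p a) \<and> (\<Sum>a\<in>A. p a) = 1 \<and>
           (\<forall>t U. \<rho> \<le> t \<and> t < 1 \<and> (\<forall>x\<in>U. \<forall>y\<in>U. d k x y \<le> t) \<longrightarrow>
              (\<Sum>a\<in>A \<inter> U. p a) \<le> C k * t powr s k)"
    using C' by simp_all
  show ?thesis
    unfolding P.discrete_frostman_def
  proof (intro exI[of _ "\<Prod>k\<in>K. C k"] conjI allI impI)
    show "0 < (\<Prod>k\<in>K. C k)" using C by (simp add: prod_pos)
    fix \<rho> :: real assume \<rho>: "0 < \<rho> \<and> \<rho> < 1"
    have "\<forall>k\<in>K. \<exists>A p. finite A \<and> A \<subseteq> G k \<and> (\<forall>a\<in>A. 0 \<le> p a) \<and> (\<Sum>a\<in>A. p a) = 1 \<and>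
           (\<forall>t U. \<rho> \<le> t \<and> t < 1 \<and> (\<forall>x\<in>U. \<forall>y\<in>U. d k x y \<le> t) \<longrightarrow>
              (\<Sum>a\<in>A \<inter> U. p a) \<le> C k * t powr s k)"
      using ex \<rho> by simp
    from bchoice[OF this] obtain A where "\<forall>k\<in>K. \<exists>p. finite (A k) \<and> A k \<subseteq> G k \<and>
        (\<forall>a\<in>A k. 0 \<le> p a) \<and> (\<Sum>a\<in>A k. p a) = 1 \<and>
           (\<forall>t U. \<rho> \<le> t \<and> t < 1 \<and> (\<forall>x\<in>U. \<forall>y\<in>U. d k x y \<le> t) \<longrightarrow>
              (\<Sum>a\<in>A k \<inter> U. p a) \<le> C k * t powr s k)"
      by (elim exE)
    from bchoice[OF this] obtain p where Ap: "\<forall>k\<in>K. finite (A k) \<and> A k \<subseteq> G k \<and>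
        (\<forall>a\<in>A k. 0 \<le> p k a) \<and> (\<Sum>a\<in>A k. p k a) = 1 \<and>
           (\<forall>t U. \<rho> \<le> t \<and> t < 1 \<and> (\<forall>x\<in>U. \<forall>y\<in>U. d k x y \<le> t) \<longrightarrow>
              (\<Sum>a\<in>A k \<inter> U. p k a) \<le> C k * t powr s k)"
      by (elim exE)
    have A: "\<And>k. k \<in> K \<Longrightarrow> finite (A k)" "\<And>k. k \<in> K \<Longrightarrow> A k \<subseteq> G k"
      and p: "\<And>k a. k \<in> K \<Longrightarrow> a \<in> A k \<Longrightarrow> 0 \<le> p k a" "\<And>k. k \<in> K \<Longrightarrow> (\<Sum>a\<in>A k. p k a) = 1"
      and bd: "\<And>k t U. k \<in> K \<Longrightarrow> \<rho> \<le> t \<Longrightarrow> t < 1 \<Longrightarrow> (\<forall>x\<in>U. \<forall>y\<in>U. d k x y \<le> t) \<Longrightarrow>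
              (\<Sum>a\<in>A k \<inter> U. p k a) \<le> C k * t powr s k"
      using Ap by simp_all
    show "\<exists>A p. finite A \<and> A \<subseteq> Pi\<^sub>E K G \<and> (\<forall>a\<in>A. 0 \<le> p a) \<and> (\<Sum>a\<in>A. p a) = 1 \<and>
           (\<forall>t U. \<rho> \<le> t \<and> t < 1 \<and> (\<forall>x\<in>U. \<forall>y\<in>U. L2_prod_dist K d x y \<le> t) \<longrightarrow>
              (\<Sum>a\<in>A \<inter> U. p a) \<le> (\<Prod>k\<in>K. C k) * t powr (\<Sum>k\<in>K. s k))"
    proof (intro exI[of _ "Pi\<^sub>E K A"] exI[of _ "\<lambda>a. \<Prod>k\<in>K. p k (a k)"] conjI ballI allI impI)
      show "finite (Pi\<^sub>E K A)" using K A by (intro finite_PiE) auto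
      show "Pi\<^sub>E K A \<subseteq> Pi\<^sub>E K G" using A(2) by (rule PiE_mono)
      show "0 \<le> (\<Prod>k\<in>K. p k (a k))" if "a \<in> Pi\<^sub>E K A" for a
        using that p(1) by (intro prod_nonneg) (auto simp: PiE_mem)
      have "(\<Sum>a\<in>Pi\<^sub>E K A. \<Prod>k\<in>K. p k (a k)) = (\<Prod>k\<in>K. \<Sum>a\<in>A k. p k a)"
        using K A(1) by (simp add: prod_sum_PiE)
      then show "(\<Sum>a\<in>Pi\<^sub>E K A. \<Prod>k\<in>K. p k (a k)) = 1" using p(2) by simp
      fix t :: real and U
      assume tU: "\<rho> \<le> t \<and> t < 1 \<and> (\<forall>x\<in>U. \<forall>y\<in>U. L2_prod_dist K d x y \<le> t)"
      define Uk where "Uk = (\<lambda>k. (\<lambda>x. x k) ` (U \<inter> Pi\<^sub>E K A))"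
      have "(\<Sum>a\<in>Pi\<^sub>E K A \<inter> U. \<Prod>k\<in>K. p k (a k)) \<le> (\<Sum>a\<in>Pi\<^sub>E K (\<lambda>k. A k \<inter> Uk k). \<Prod>k\<in>K. p k (a k))"
      proof (rule sum_mono2)
        show "finite (Pi\<^sub>E K (\<lambda>k. A k \<inter> Uk k))" using K A by (intro finite_PiE) auto
        show "Pi\<^sub>E K A \<inter> U \<subseteq> Pi\<^sub>E K (\<lambda>k. A k \<inter> Uk k)"
          by (auto simp: PiE_iff Uk_def)
        show "0 \<le> (\<Prod>k\<in>K. p k (b k))" if "b \<in> Pi\<^sub>E K (\<lambda>k. A k \<inter> Uk k) - Pi\<^sub>E K A \<inter> U" for b
          using that p(1) by (intro prod_nonneg) (auto simp: PiE_iff)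
      qed
      also have "\<dots> = (\<Prod>k\<in>K. \<Sum>a\<in>A k \<inter> Uk k. p k a)"
        using K A(1) by (simp add: prod_sum_PiE)
      also have "\<dots> \<le> (\<Prod>k\<in>K. C k * t powr s k)"
      proof (rule prod_mono, intro conjI)
        fix k assume k: "k \<in> K"
        interpret Metric_space "X k" "d k" by (rule X[OF k])
        show "0 \<le> (\<Sum>a\<in>A k \<inter> Uk k. p k a)" using p(1)[OF k] by (intro sum_nonneg) auto
        show "(\<Sum>a\<in>A k \<inter> Uk k. p k a) \<le> C k * t powr s k"
        proof (rule bd[OF k])
          show "\<forall>x\<in>Uk k. \<forall>y\<in>Uk k. d k x y \<le> t"
          proof (intro ballI)
            fix x y assume "x \<in> Uk k" "y \<in> Uk k"
            then obtain x' y' where xy: "x' \<in> U" "y' \<in> U" "x = x' k" "y = y' k"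
              by (auto simp: Uk_def)
            have "d k (x' k) (y' k) \<le> L2_prod_dist K d x' y'"
              unfolding L2_prod_dist_def
              by (rule member_le_L2_set[OF K k, of "\<lambda>k. d k (x' k) (y' k)"])
            then show "d k x y \<le> t" using tU xy by fastforce
          qed
        qed (use tU in auto)
      qed
      also have "\<dots> = (\<Prod>k\<in>K. C k) * t powr (\<Sum>k\<in>K. s k)"
        using tU \<rho> by (simp add: prod.distrib powr_sum)
      finally show "(\<Sum>a\<in>Pi\<^sub>E K A \<inter> U. \<Prod>k\<in>K. p k (a k)) \<le> (\<Prod>k\<in>K. C k) * t powr (\<Sum>k\<in>K. s k)" .
    qed
  qed
qed

section \<open>Separated points and similarities in Euclidean space\<close>

lemma abs_coordinate_le_eucl_dist:
  assumes "i < n"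
  shows "\<bar>x i - y i\<bar> \<le> eucl_dist n x y"
  unfolding eucl_dist_def
  using member_le_L2_set[of "{..<n}" i "\<lambda>i. \<bar>x i - y i\<bar>"] assms by (simp add: L2_set_def)

text \<open>Euclidean space is doubling: the number of \<open>\<delta>\<close>-separated points in a ball of radius \<open>L * \<delta>\<close> is bounded
in terms of \<open>n\<close> and \<open>L\<close>. Points in the same cell of a grid of mesh \<open>\<delta> / (n + 1)\<close> are closer than
\<open>\<delta>\<close>, so each cell contains at most one point of the set.\<close>
lemma separated_card_bounded:
  fixes L :: real
  obtains B where "\<And>S z R \<delta>. 0 < \<delta> \<Longrightarrow> R \<le> L * \<delta> \<Longrightarrow> \<forall>x\<in>S. eucl_dist n z x \<le> R \<Longrightarrow>
    \<forall>x\<in>S. \<forall>y\<in>S. x \<noteq> y \<longrightarrow> \<delta> \<le> eucl_dist n x y \<Longrightarrow> card S \<le> B"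
proof -
  define h where "h = real n + 1"
  define b where "b = \<lceil>L * h\<rceil> + 1"
  define T where "T = Pi\<^sub>E {..<n} (\<lambda>_. {- b..b})"
  have "h > 0" by (simp add: h_def)
  have "finite T" unfolding T_def by (intro finite_PiE) auto
  have le: "card S \<le> card T"
    if "0 < \<delta>" "R \<le> L * \<delta>" and R: "\<forall>x\<in>S. eucl_dist n z x \<le> R"
      and sep: "\<forall>x\<in>S. \<forall>y\<in>S. x \<noteq> y \<longrightarrow> \<delta> \<le> eucl_dist n x y" for S z R \<delta>
  proof (rule card_inj_on_le[OF _ _ \<open>finite T\<close>])
    define q where "q = (\<lambda>x. \<lambda>i\<in>{..<n}. \<lfloor>(x i - z i) * (h / \<delta>)\<rfloor>)"
    show "q ` S \<subseteq> T"
    proof (clarsimp simp: T_def q_def)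
      fix x i assume "x \<in> S" "i < n"
      have "\<bar>(x i - z i) * (h / \<delta>)\<bar> = \<bar>z i - x i\<bar> * (h / \<delta>)"
        using \<open>0 < \<delta>\<close> \<open>0 < h\<close> by (simp add: abs_mult abs_minus_commute)
      also have "\<dots> \<le> (L * \<delta>) * (h / \<delta>)"
        using abs_coordinate_le_eucl_dist[OF \<open>i < n\<close>, of z x] R \<open>x \<in> S\<close> \<open>R \<le> L * \<delta>\<close> \<open>0 < \<delta>\<close> \<open>0 < h\<close>
        by (intro mult_right_mono) force+
      also have "\<dots> = L * h" using \<open>0 < \<delta>\<close> by simp
      finally have "\<bar>(x i - z i) * (h / \<delta>)\<bar> \<le> L * h" .
      then have "- b \<le> \<lfloor>(x i - z i) * (h / \<delta>)\<rfloor> \<and> \<lfloor>(x i - z i) * (h / \<delta>)\<rfloor> \<le> b"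
        unfolding b_def by linarith
      then show "- b \<le> \<lfloor>(x i - z i) * h / \<delta>\<rfloor> \<and> \<lfloor>(x i - z i) * h / \<delta>\<rfloor> \<le> b" by simp
    qed
    show "inj_on q S"
    proof (rule inj_onI, rule ccontr)
      fix x y assume xy: "x \<in> S" "y \<in> S" "q x = q y" "x \<noteq> y"
      have "\<bar>x i - y i\<bar> \<le> \<delta> / h" if "i < n" for i
      proof -
        have "\<lfloor>(x i - z i) * (h / \<delta>)\<rfloor> = \<lfloor>(y i - z i) * (h / \<delta>)\<rfloor>"
          using fun_cong[OF \<open>q x = q y\<close>, of i] that by (simp add: q_def)
        then have "\<bar>(x i - z i) * (h / \<delta>) - (y i - z i) * (h / \<delta>)\<bar> \<le> 1" by linarith
        also have "(x i - z i) * (h / \<delta>) - (y i - z i) * (h / \<delta>) = (x i - y i) * (h / \<delta>)"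
          by (simp add: algebra_simps diff_divide_distrib)
        finally have "\<bar>x i - y i\<bar> * (h / \<delta>) \<le> 1"
          using \<open>0 < \<delta>\<close> \<open>0 < h\<close> by (simp add: abs_mult)
        then show ?thesis
          using \<open>0 < \<delta>\<close> \<open>0 < h\<close> by (simp add: pos_le_divide_eq pos_divide_le_eq)
      qed
      then have "(\<Sum>i<n. \<bar>x i - y i\<bar>) \<le> (\<Sum>i<n. \<delta> / h)" by (intro sum_mono) auto
      moreover have "eucl_dist n x y \<le> (\<Sum>i<n. \<bar>x i - y i\<bar>)"
        unfolding eucl_dist_def by (rule L2_set_le_sum_abs)
      moreover have "(\<Sum>i<n. \<delta> / h) < \<delta>"
        using \<open>0 < \<delta>\<close> by (simp add: h_def field_simps)
      ultimately show False using sep xy by force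
    qed
  qed
  show thesis by (rule that[of "card T"]) (erule (3) le)
qed

text \<open>If \<open>y\<close> had distance at least \<open>\<epsilon>\<close> from the range of \<open>g\<close>, then the orbit of \<open>y\<close> under \<open>g\<close> would be an
infinite \<open>\<epsilon>\<close>-separated set, since \<open>g\<close> preserves distances; but it stays on a sphere around the fixed
point \<open>0\<close>, where separated sets are finite.\<close>
lemma isometry_range_dense:
  assumes g: "g \<in> eucl n \<rightarrow> eucl n" "g (\<lambda>_. 0) = (\<lambda>_. 0)"
    and iso: "\<And>x y. x \<in> eucl n \<Longrightarrow> y \<in> eucl n \<Longrightarrow> eucl_dist n (g x) (g y) = eucl_dist n x y"
    and y: "y \<in> eucl n" and "0 < \<epsilon>"
  shows "\<exists>z\<in>eucl n. eucl_dist n (g z) y < \<epsilon>"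
proof (rule ccontr)
  interpret Metric_space "eucl n" "eucl_dist n" by (rule Metric_space_eucl)
  assume "\<not> ?thesis"
  then have far: "\<And>z. z \<in> eucl n \<Longrightarrow> \<epsilon> \<le> eucl_dist n (g z) y" by force
  have 0: "(\<lambda>_. 0) \<in> eucl n" by (simp add: topspace_Euclidean_space)
  have orbit: "(g ^^ j) x \<in> eucl n" if "x \<in> eucl n" for j x
    using that g(1) by (induction j) auto
  have iso_pow: "eucl_dist n ((g ^^ j) x) ((g ^^ j) x') = eucl_dist n x x'"
    if "x \<in> eucl n" "x' \<in> eucl n" for j x x'
    using that by (induction j) (auto simp: iso orbit)
  define R where "R = eucl_dist n (\<lambda>_. 0) y"
  have fix0: "(g ^^ j) (\<lambda>_. 0) = (\<lambda>_. 0)" for j using g(2) by (induction j) auto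
  have radius: "eucl_dist n (\<lambda>_. 0) ((g ^^ j) y) = R" for j
    using iso_pow[OF 0 y, of j] by (simp add: fix0 R_def)
  have sep_less: "\<epsilon> \<le> eucl_dist n ((g ^^ i) y) ((g ^^ j) y)" if "i < j" for i j
  proof -
    obtain k where j: "j = i + Suc k" using \<open>i < j\<close> less_iff_Suc_add by auto
    have "(g ^^ j) y = (g ^^ i) ((g ^^ Suc k) y)"
      by (simp only: j funpow_add o_apply)
    then have "eucl_dist n ((g ^^ i) y) ((g ^^ j) y) = eucl_dist n y (g ((g ^^ k) y))"
      using iso_pow[OF y orbit[OF y, of "Suc k"], of i] by simp
    then show ?thesis using far[OF orbit[OF y, of k]] by (simp add: commute)
  qed
  have sep: "\<epsilon> \<le> eucl_dist n ((g ^^ i) y) ((g ^^ j) y)" if "i \<noteq> j" for i j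
    using sep_less[of i j] sep_less[of j i] that by (metis commute nat_neq_iff)
  obtain B where B: "\<And>S z R' \<delta>. 0 < \<delta> \<Longrightarrow> R' \<le> (R / \<epsilon>) * \<delta> \<Longrightarrow> \<forall>x\<in>S. eucl_dist n z x \<le> R' \<Longrightarrow>
    \<forall>x\<in>S. \<forall>y\<in>S. x \<noteq> y \<longrightarrow> \<delta> \<le> eucl_dist n x y \<Longrightarrow> card S \<le> B"
    by (rule separated_card_bounded) (rule that)
  define S where "S = (\<lambda>j. (g ^^ j) y) ` {..B}"
  have "inj_on (\<lambda>j. (g ^^ j) y) {..B}"
  proof (rule inj_onI, rule ccontr)
    fix i j assume "(g ^^ i) y = (g ^^ j) y" "i \<noteq> j"
    then have "\<epsilon> \<le> eucl_dist n ((g ^^ j) y) ((g ^^ j) y)" using sep[of i j] by simp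
    then show False using \<open>0 < \<epsilon>\<close> orbit[OF y] by simp
  qed
  then have "card S = Suc B" by (simp add: S_def card_image)
  moreover have "card S \<le> B"
  proof (rule B[OF \<open>0 < \<epsilon>\<close>])
    show "R \<le> R / \<epsilon> * \<epsilon>" using \<open>0 < \<epsilon>\<close> by simp
    show "\<forall>x\<in>S. eucl_dist n (\<lambda>_. 0) x \<le> R" by (simp add: S_def radius)
    show "\<forall>x\<in>S. \<forall>y\<in>S. x \<noteq> y \<longrightarrow> \<epsilon> \<le> eucl_dist n x y"
    proof (intro ballI impI)
      fix u v assume "u \<in> S" "v \<in> S" "u \<noteq> v"
      then obtain i j where "u = (g ^^ i) y" "v = (g ^^ j) y" "i \<noteq> j" by (auto simp: S_def)
      then show "\<epsilon> \<le> eucl_dist n u v" using sep[of i j] by simp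
    qed
  qed
  ultimately show False by simp
qed

lemma eucl_dist_scale:
  assumes "0 < c"
  shows "eucl_dist n (\<lambda>i. (x i - a i) / c) (\<lambda>i. (y i - a i) / c) = eucl_dist n x y / c"
proof -
  have "(\<lambda>i. (x i - a i) / c - (y i - a i) / c) = (\<lambda>i. (x i - y i) * (1 / c))"
    by (auto simp: diff_divide_distrib)
  then show ?thesis
    unfolding eucl_dist_def using L2_set_left_distrib[of "1 / c" "\<lambda>i. x i - y i" "{..<n}"] assms
    by simp
qed

text \<open>A similarity becomes an isometry fixing \<open>0\<close> after normalization, so its range is dense; by completeness
the range is also closed.\<close>
lemma similarity_surj:
  assumes comp: "Metric_space.mcomplete (eucl n) (eucl_dist n)"
    and f: "f \<in> eucl n \<rightarrow> eucl n" and "0 < c"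
    and sim: "\<And>x y. x \<in> eucl n \<Longrightarrow> y \<in> eucl n \<Longrightarrow> eucl_dist n (f x) (f y) = c * eucl_dist n x y"
  shows "eucl n \<subseteq> f ` eucl n"
proof
  interpret Metric_space "eucl n" "eucl_dist n" by (rule Metric_space_eucl)
  fix y assume y: "y \<in> eucl n"
  have 0: "(\<lambda>_. 0) \<in> eucl n" by (simp add: topspace_Euclidean_space)
  define a where "a = f (\<lambda>_. 0)"
  have a: "a \<in> eucl n" using f 0 by (auto simp: a_def)
  define g where "g = (\<lambda>x i. (f x i - a i) / c)"
  define y' where "y' = (\<lambda>i. (y i - a i) / c)"
  have y': "y' \<in> eucl n" using y a by (simp add: y'_def topspace_Euclidean_space)
  have approx: "\<exists>z\<in>eucl n. eucl_dist n (f z) y < e" if "0 < e" for e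
  proof -
    have "\<exists>z\<in>eucl n. eucl_dist n (g z) y' < e / c"
    proof (rule isometry_range_dense[OF _ _ _ y'])
      show "g \<in> eucl n \<rightarrow> eucl n"
        using f a by (force simp: g_def topspace_Euclidean_space)
      show "g (\<lambda>_. 0) = (\<lambda>_. 0)" by (simp add: g_def a_def)
      show "0 < e / c" using that \<open>0 < c\<close> by simp
      fix x z assume "x \<in> eucl n" "z \<in> eucl n"
      then show "eucl_dist n (g x) (g z) = eucl_dist n x z"
        using \<open>0 < c\<close> by (simp add: g_def eucl_dist_scale sim)
    qed
    then show ?thesis
      using \<open>0 < c\<close> by (simp add: g_def y'_def eucl_dist_scale divide_less_cancel)
  qed
  have "\<forall>j. \<exists>z. z \<in> eucl n \<and> eucl_dist n (f z) y < c * (1 / Suc j)"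
    using approx \<open>0 < c\<close> by (simp add: Bex_def)
  from choice[OF this] obtain z where z: "\<And>j. z j \<in> eucl n" "\<And>j. eucl_dist n (f (z j)) y < c * (1 / Suc j)"
    by auto
  have fz: "f (z j) \<in> eucl n" for j using f z(1) by auto
  have "MCauchy z"
    unfolding MCauchy_def
  proof (intro conjI allI impI)
    show "range z \<subseteq> eucl n" using z(1) by auto
    fix \<epsilon> :: real assume "0 < \<epsilon>"
    then obtain m where m: "1 / Suc m < \<epsilon> / 2" using nat_approx_posE[of "\<epsilon> / 2"] by auto
    show "\<exists>N. \<forall>j k. N \<le> j \<longrightarrow> N \<le> k \<longrightarrow> eucl_dist n (z j) (z k) < \<epsilon>"
    proof (intro exI allI impI)
      fix j k assume jk: "m \<le> j" "m \<le> k"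
      have le: "1 / Suc j \<le> 1 / Suc m" "1 / Suc k \<le> 1 / Suc m"
        using jk by (simp_all add: frac_le)
      have "c * eucl_dist n (z j) (z k) = eucl_dist n (f (z j)) (f (z k))" by (simp add: sim z)
      also have "\<dots> \<le> eucl_dist n (f (z j)) y + eucl_dist n y (f (z k))"
        using fz y by (intro triangle)
      also have "\<dots> < c * (1 / Suc j) + c * (1 / Suc k)"
        using z(2)[of j] z(2)[of k] by (simp add: commute)
      also have "\<dots> = c * (1 / Suc j + 1 / Suc k)" by (simp add: distrib_left)
      also have "\<dots> \<le> c * \<epsilon>" using le m \<open>0 < c\<close> by (intro mult_left_mono) linarith+
      finally show "eucl_dist n (z j) (z k) < \<epsilon>" using \<open>0 < c\<close> by simp
    qed
  qed
  then obtain x where "limitin mtopology z x sequentially"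
    using comp unfolding mcomplete_def by auto
  then have x: "x \<in> eucl n" and lim: "\<And>\<epsilon>. 0 < \<epsilon> \<Longrightarrow> \<exists>N. \<forall>j\<ge>N. z j \<in> eucl n \<and> eucl_dist n (z j) x < \<epsilon>"
    by (auto simp: limit_metric_sequentially)
  have fx: "f x \<in> eucl n" using f x by auto
  have "eucl_dist n (f x) y \<le> 0"
  proof (rule field_le_epsilon)
    fix e :: real assume "0 < e"
    define \<epsilon> where "\<epsilon> = e / (2 * c)"
    have "0 < \<epsilon>" using \<open>0 < e\<close> \<open>0 < c\<close> by (simp add: \<epsilon>_def)
    obtain N where N: "\<And>j. j \<ge> N \<Longrightarrow> eucl_dist n (z j) x < \<epsilon>" using lim[OF \<open>0 < \<epsilon>\<close>] by auto
    obtain m where m: "1 / Suc m < \<epsilon>" using nat_approx_posE[OF \<open>0 < \<epsilon>\<close>] by auto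
    define j where "j = max N m"
    have "1 / Suc j \<le> 1 / Suc m" by (simp add: j_def frac_le)
    then have "c * (1 / Suc j) \<le> c * \<epsilon>" using m \<open>0 < c\<close> by (intro mult_left_mono) linarith+
    moreover have "eucl_dist n (f x) (f (z j)) = c * eucl_dist n (z j) x"
      by (simp add: sim x z commute)
    moreover have "c * eucl_dist n (z j) x \<le> c * \<epsilon>"
      using N[of j] \<open>0 < c\<close> by (intro mult_left_mono) (auto simp: j_def)
    moreover have "eucl_dist n (f x) y \<le> eucl_dist n (f x) (f (z j)) + eucl_dist n (f (z j)) y"
      using fx fz y by (intro triangle)
    moreover have "c * \<epsilon> + c * \<epsilon> = e" using \<open>0 < c\<close> by (simp add: \<epsilon>_def)
    ultimately show "eucl_dist n (f x) y \<le> 0 + e" using z(2)[of j] by linarith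
  qed
  then have "eucl_dist n (f x) y = 0" using nonneg[of "f x" y] by linarith
  then have "f x = y" using fx y by simp
  then show "y \<in> f ` eucl n" using x by auto
qed

section \<open>Covers of self-similar sets\<close>

text \<open>For negative \<open>s\<close> every positive ratio contributes more than \<open>1\<close> to the sum.\<close>
lemma similarity_exponent_nonneg:
  fixes c :: "'i \<Rightarrow> real"
  assumes "finite I" and c: "\<And>i. i \<in> I \<Longrightarrow> 0 \<le> c i \<and> c i < 1" and sum: "(\<Sum>i\<in>I. c i powr s) = 1"
  shows "0 \<le> s"
proof (rule ccontr)
  assume "\<not> 0 \<le> s"
  have "\<exists>i\<in>I. c i powr s \<noteq> 0"
    using sum by (metis (no_types, lifting) sum.neutral zero_neq_one)
  then obtain i where i: "i \<in> I" "c i \<noteq> 0" by auto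
  have "1 powr s < c i powr s"
    using c[OF i(1)] i(2) \<open>\<not> 0 \<le> s\<close> by (intro powr_less_mono2_neg) auto
  also have "c i powr s \<le> (\<Sum>i\<in>I. c i powr s)"
    using i(1) \<open>finite I\<close> by (intro member_le_sum) auto
  finally show False using sum by simp
qed

lemma weight_sum_less_1:
  fixes c :: "'i \<Rightarrow> real"
  assumes "finite I" and c: "\<And>i. i \<in> I \<Longrightarrow> 0 \<le> c i \<and> c i \<le> b" and "0 \<le> b" "b < 1"
    and sum: "(\<Sum>i\<in>I. c i powr s) = 1" and "0 < \<epsilon>"
  shows "(\<Sum>i\<in>I. c i powr (s + \<epsilon>)) < 1"
proof -
  have "(\<Sum>i\<in>I. c i powr (s + \<epsilon>)) \<le> (\<Sum>i\<in>I. c i powr s * b powr \<epsilon>)"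
  proof (rule sum_mono)
    fix i assume "i \<in> I"
    have "c i powr \<epsilon> \<le> b powr \<epsilon>"
      using c[OF \<open>i \<in> I\<close>] \<open>0 < \<epsilon>\<close> by (intro powr_mono2) auto
    then show "c i powr (s + \<epsilon>) \<le> c i powr s * b powr \<epsilon>"
      by (simp add: powr_add mult_left_mono)
  qed
  also have "\<dots> = b powr \<epsilon>" by (simp add: sum sum_distrib_right[symmetric])
  also have "\<dots> < 1 powr \<epsilon>"
    using assms by (intro powr_less_mono2) auto
  finally show ?thesis by simp
qed

lemma finite_ratio_bound:
  fixes c :: "'i \<Rightarrow> real"
  assumes "finite I" and "\<And>i. i \<in> I \<Longrightarrow> c i < 1"
  obtains b where "0 < b" "b < 1" "\<And>i. i \<in> I \<Longrightarrow> c i \<le> b"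
proof
  define b where "b = Max (insert (1/2) (c ` I))"
  show "c i \<le> b" if "i \<in> I" for i unfolding b_def using that assms(1) by (intro Max_ge) auto
  have "1/2 \<le> b" unfolding b_def using assms(1) by (intro Max_ge) auto
  then show "0 < b" by simp
  show "b < 1" unfolding b_def using assms by (subst Max_less_iff) auto
qed

context Metric_space
begin

text \<open>The ratios satisfy \<open>q = (\<Sum>i\<in>I. c i powr \<sigma>) < 1\<close> for \<open>\<sigma> > s\<close>. Since \<open>G\<close> is the union of its images, covers of
\<open>G\<close> by balls of radius \<open>r / c i\<close>, transported by \<open>f i\<close>, combine to a cover by balls of radius \<open>r\<close>.
If \<open>1 + C * r powr -\<sigma>\<close> balls suffice at the larger radii, then at radius \<open>r\<close> their total number is at
most \<open>card I + q * C * r powr -\<sigma>\<close>. The room left by \<open>q < 1\<close> absorbs the additive term when \<open>C\<close> is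
large enough, and so the bound propagates to all small radii. The summand \<open>1\<close> accounts for maps of ratio \<open>0\<close>,
whose image of \<open>G\<close> is a single point.\<close>
lemma covering_exponent_le_attractor:
  assumes I: "finite I" and sim: "\<And>i. i \<in> I \<Longrightarrow> contraction_similarity (f i) (c i)"
    and att: "is_attractor I f G" and sum: "(\<Sum>i\<in>I. c i powr s) = 1"
  shows "covering_exponent_le G s"
  unfolding covering_exponent_le_def
proof (intro allI impI)
  fix \<epsilon> :: real assume "0 < \<epsilon>"
  have c: "\<And>i. i \<in> I \<Longrightarrow> 0 \<le> c i \<and> c i < 1"
    and fM: "\<And>i x. i \<in> I \<Longrightarrow> x \<in> M \<Longrightarrow> f i x \<in> M"
    and fd: "\<And>i x y. i \<in> I \<Longrightarrow> x \<in> M \<Longrightarrow> y \<in> M \<Longrightarrow> d (f i x) (f i y) = c i * d x y"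
    using sim unfolding contraction_similarity_def by auto
  have G: "G \<noteq> {}" "compactin mtopology G" "G = (\<Union>i\<in>I. f i ` G)"
    using att unfolding is_attractor_def by simp_all
  have GM: "G \<subseteq> M" using compactin_subset_topspace[OF G(2)] by simp
  obtain x0 where x0: "x0 \<in> G" using G(1) by auto
  have "s \<ge> 0" using similarity_exponent_nonneg[OF I c sum] .
  obtain b where b: "0 < b" "b < 1" "\<And>i. i \<in> I \<Longrightarrow> c i \<le> b"
    using finite_ratio_bound[OF I] c by auto
  define \<sigma> where "\<sigma> = s + \<epsilon>"
  have "\<sigma> > 0" using \<open>s \<ge> 0\<close> \<open>\<epsilon> > 0\<close> by (simp add: \<sigma>_def)
  define q where "q = (\<Sum>i\<in>I. c i powr \<sigma>)"
  have "q < 1"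
    unfolding q_def \<sigma>_def
    by (rule weight_sum_less_1[OF I _ _ b(2) sum \<open>0 < \<epsilon>\<close>]) (use b c in auto)
  have "mbounded G" using G(2) by (rule compactin_imp_mbounded)
  then obtain D where "0 < D" and D: "\<And>x y. x \<in> G \<Longrightarrow> y \<in> G \<Longrightarrow> d x y \<le> D"
    unfolding mbounded_alt_pos by auto
  define C where "C = card I * D powr \<sigma> / (1 - q)"
  have "C \<ge> 0" using \<open>q < 1\<close> by (simp add: C_def)
  have single: "\<exists>E. finite E \<and> E \<subseteq> M \<and> G \<subseteq> (\<Union>x\<in>E. mball x r) \<and> real (card E) \<le> 1 + C * r powr - \<sigma>"
    if "D < r" for r
  proof (intro exI[of _ "{x0}"] conjI)
    show "G \<subseteq> (\<Union>x\<in>{x0}. mball x r)"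
      using D[OF x0] that GM x0 by force
  qed (use x0 GM \<open>C \<ge> 0\<close> in auto)
  \<comment> \<open>induction on the number of steps that bring the radius above the diameter bound \<open>D\<close>\<close>
  have claim: "\<exists>E. finite E \<and> E \<subseteq> M \<and> G \<subseteq> (\<Union>x\<in>E. mball x r) \<and> real (card E) \<le> 1 + C * r powr - \<sigma>"
    if "0 < r" "D * b ^ k < r" for r k
    using that
  proof (induction k arbitrary: r)
    case 0
    then show ?case by (intro single) simp
  next
    case (Suc k)
    show ?case
    proof (cases "D < r")
      case True
      then show ?thesis by (rule single)
    next
      case False
      have "\<forall>i\<in>I. \<exists>E. finite E \<and> E \<subseteq> M \<and> f i ` G \<subseteq> (\<Union>x\<in>E. mball x r) \<and>
          real (card E) \<le> 1 + C * (c i powr \<sigma> * r powr - \<sigma>)"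
      proof
        fix i assume i: "i \<in> I"
        show "\<exists>E. finite E \<and> E \<subseteq> M \<and> f i ` G \<subseteq> (\<Union>x\<in>E. mball x r) \<and>
          real (card E) \<le> 1 + C * (c i powr \<sigma> * r powr - \<sigma>)"
        proof (cases "c i = 0")
          case True
          have "f i ` G \<subseteq> mball (f i x0) r"
          proof
            fix y assume "y \<in> f i ` G"
            then obtain x where "x \<in> G" "y = f i x" by auto
            then have "x \<in> M" "x0 \<in> M" using x0 GM by auto
            then have "d (f i x0) y = 0" using fd[OF i, of x0 x] True \<open>y = f i x\<close> by simp
            then show "y \<in> mball (f i x0) r"
              using fM[OF i] \<open>x \<in> M\<close> \<open>x0 \<in> M\<close> \<open>y = f i x\<close> \<open>0 < r\<close> by simp
          qed
          then show ?thesis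
            using fM[OF i] x0 GM \<open>C \<ge> 0\<close> by (intro exI[of _ "{f i x0}"]) auto
        next
          case False
          then have "c i > 0" using c[OF i] by simp
          have "D * b ^ k * c i \<le> D * b ^ k * b"
            using b i \<open>0 < D\<close> by (intro mult_left_mono) auto
          then have "D * b ^ k < r / c i"
            using Suc.prems(2) \<open>c i > 0\<close> by (simp add: pos_less_divide_eq mult_ac)
          moreover have "0 < r / c i" using \<open>0 < r\<close> \<open>c i > 0\<close> by simp
          ultimately have "\<exists>E. finite E \<and> E \<subseteq> M \<and> G \<subseteq> (\<Union>x\<in>E. mball x (r / c i)) \<and>
              real (card E) \<le> 1 + C * (r / c i) powr - \<sigma>"
            by (intro Suc.IH)
          then obtain E where E: "finite E" "E \<subseteq> M" "G \<subseteq> (\<Union>x\<in>E. mball x (r / c i))"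
            "real (card E) \<le> 1 + C * (r / c i) powr - \<sigma>"
            by (elim exE conjE)
          show ?thesis
          proof (intro exI[of _ "f i ` E"] conjI)
            show "finite (f i ` E)" using E by simp
            show "f i ` E \<subseteq> M" using E fM[OF i] by auto
            show "f i ` G \<subseteq> (\<Union>x\<in>f i ` E. mball x r)"
            proof
              fix y assume "y \<in> f i ` G"
              then obtain x where x: "x \<in> G" "y = f i x" by auto
              then obtain e where e: "e \<in> E" "x \<in> mball e (r / c i)" using E(3) by auto
              then have "d (f i e) (f i x) < r"
                using fd[OF i, of e x] \<open>c i > 0\<close> by (simp add: pos_less_divide_eq mult.commute)
              then have "y \<in> mball (f i e) r" using e x fM[OF i] by simp
              then show "y \<in> (\<Union>x\<in>f i ` E. mball x r)" using e by auto
            qed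
            have "real (card (f i ` E)) \<le> 1 + C * (r / c i) powr - \<sigma>"
              using E(4) card_image_le[OF E(1), of "f i"] by linarith
            also have "(r / c i) powr - \<sigma> = c i powr \<sigma> * r powr - \<sigma>"
              using \<open>0 < r\<close> \<open>c i > 0\<close> by (simp add: powr_divide powr_minus field_simps)
            finally show "real (card (f i ` E)) \<le> 1 + C * (c i powr \<sigma> * r powr - \<sigma>)" .
          qed
        qed
      qed
      from bchoice[OF this] obtain E where E: "\<forall>i\<in>I. finite (E i) \<and> E i \<subseteq> M \<and>
          f i ` G \<subseteq> (\<Union>x\<in>E i. mball x r) \<and> real (card (E i)) \<le> 1 + C * (c i powr \<sigma> * r powr - \<sigma>)"
        by (elim exE)
      show ?thesis
      proof (intro exI[of _ "\<Union>i\<in>I. E i"] conjI)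
        show "finite (\<Union>i\<in>I. E i)" using E I by simp
        show "(\<Union>i\<in>I. E i) \<subseteq> M" using E by auto
        have "(\<Union>i\<in>I. f i ` G) \<subseteq> (\<Union>x\<in>(\<Union>i\<in>I. E i). mball x r)"
        proof (rule UN_least)
          fix i assume i: "i \<in> I"
          then have "f i ` G \<subseteq> (\<Union>x\<in>E i. mball x r)" using E by simp
          also have "\<dots> \<subseteq> (\<Union>x\<in>(\<Union>i\<in>I. E i). mball x r)" using i by (intro UN_mono) auto
          finally show "f i ` G \<subseteq> (\<Union>x\<in>(\<Union>i\<in>I. E i). mball x r)" .
        qed
        then show "G \<subseteq> (\<Union>x\<in>(\<Union>i\<in>I. E i). mball x r)" by (subst G(3))
        have "real (card (\<Union>i\<in>I. E i)) \<le> (\<Sum>i\<in>I. real (card (E i)))"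
          using card_UN_le[OF I, of E] by (metis of_nat_le_iff of_nat_sum)
        also have "\<dots> \<le> (\<Sum>i\<in>I. 1 + C * (c i powr \<sigma> * r powr - \<sigma>))"
          using E by (intro sum_mono) simp
        also have "\<dots> = card I + C * q * r powr - \<sigma>"
          by (simp add: sum.distrib q_def sum_distrib_left sum_distrib_right mult.assoc)
        also have "\<dots> \<le> C * r powr - \<sigma>"
        proof -
          have "1 \<le> D powr \<sigma> * r powr - \<sigma>"
            using powr_mono2[of \<sigma> r D] False \<open>0 < r\<close> \<open>0 < \<sigma>\<close> by (simp add: powr_minus field_simps)
          then have "real (card I) * 1 \<le> real (card I) * (D powr \<sigma> * r powr - \<sigma>)" by (intro mult_left_mono) auto
          also have "\<dots> = C * (1 - q) * r powr - \<sigma>" using \<open>q < 1\<close> by (simp add: C_def)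
          finally show ?thesis by (simp add: algebra_simps)
        qed
        finally show "real (card (\<Union>i\<in>I. E i)) \<le> 1 + C * r powr - \<sigma>" by simp
      qed
    qed
  qed
  show "\<exists>C>0. \<forall>r. 0 < r \<and> r < 1 \<longrightarrow>
        (\<exists>E. finite E \<and> E \<subseteq> M \<and> G \<subseteq> (\<Union>x\<in>E. mball x r) \<and> real (card E) \<le> C * r powr - (s + \<epsilon>))"
  proof (intro exI[of _ "1 + C"] conjI allI impI)
    show "0 < 1 + C" using \<open>C \<ge> 0\<close> by simp
    fix r :: real assume r: "0 < r \<and> r < 1"
    have "0 < r / D" using r \<open>0 < D\<close> by simp
    then obtain k where "b ^ k < r / D" using real_arch_pow_inv b(2) by blast
    then have "D * b ^ k < r" using \<open>0 < D\<close> by (simp add: pos_less_divide_eq mult.commute)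
    from claim[OF _ this] r obtain E where E: "finite E" "E \<subseteq> M" "G \<subseteq> (\<Union>x\<in>E. mball x r)"
      "real (card E) \<le> 1 + C * r powr - \<sigma>"
      by auto
    have "1 \<le> r powr - \<sigma>" using powr_mono2'[of "- \<sigma>" r 1] r \<open>0 < \<sigma>\<close> by simp
    then have "real (card E) \<le> (1 + C) * r powr - (s + \<epsilon>)"
      using E(4) by (simp add: \<sigma>_def[symmetric] distrib_right)
    then show "\<exists>E. finite E \<and> E \<subseteq> M \<and> G \<subseteq> (\<Union>x\<in>E. mball x r) \<and>
        real (card E) \<le> (1 + C) * r powr - (s + \<epsilon>)"
      using E by (intro exI[of _ E]) simp
  qed
qed

end

section \<open>Words and stopping prefixes\<close>

text \<open>A word \<open>w\<close> over the index set encodes the composition \<open>foldr f w\<close> of the maps of the system; its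
contraction ratio is \<open>prod_list (map c w)\<close>.\<close>
abbreviation words :: "'i set \<Rightarrow> nat \<Rightarrow> 'i list set" where
  "words I n \<equiv> {w. set w \<subseteq> I \<and> length w = n}"

lemma sum_words:
  fixes p :: "'i \<Rightarrow> real"
  assumes "finite I"
  shows "(\<Sum>w\<in>words I n. prod_list (map p w)) = (\<Sum>i\<in>I. p i) ^ n"
proof (induction n)
  case 0
  have "words I 0 = {[]}" by auto
  then show ?case by simp
next
  case (Suc n)
  have "words I (Suc n) = (\<lambda>(i, w). i # w) ` (I \<times> words I n)"
    by (auto simp: length_Suc_conv image_iff)
  moreover have "inj_on (\<lambda>(i, w). i # w) (I \<times> words I n)"
    by (auto simp: inj_on_def)
  ultimately have "(\<Sum>w\<in>words I (Suc n). prod_list (map p w)) =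
      (\<Sum>(i, w)\<in>I \<times> words I n. p i * prod_list (map p w))"
    by (simp add: sum.reindex case_prod_unfold)
  also have "\<dots> = (\<Sum>i\<in>I. p i) * (\<Sum>w\<in>words I n. prod_list (map p w))"
    by (simp add: sum.cartesian_product[symmetric] sum_product)
  finally show ?case using Suc.IH by simp
qed

text \<open>For a probability vector \<open>p\<close>, the weight of a word is the total weight of its extensions of any fixed length.
Grouping the words of \<open>S\<close> by the chosen prefix therefore can only increase the weight.\<close>
lemma sum_words_le_sum_prefixes:
  fixes p :: "'i \<Rightarrow> real"
  assumes I: "finite I" and p: "\<And>i. i \<in> I \<Longrightarrow> 0 \<le> p i" and sum: "(\<Sum>i\<in>I. p i) = 1"
    and S: "S \<subseteq> words I n" and \<pi>: "\<And>w. w \<in> S \<Longrightarrow> prefix (\<pi> w) w"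
  shows "(\<Sum>w\<in>S. prod_list (map p w)) \<le> (\<Sum>v\<in>\<pi> ` S. prod_list (map p v))"
proof -
  have pos: "0 \<le> prod_list (map p w)" if "set w \<subseteq> I" for w
    using that p by (induction w) auto
  have fin: "finite (words I k)" for k using I by (rule finite_lists_length_eq)
  have "finite S" using S fin by (rule finite_subset)
  then have "(\<Sum>w\<in>S. prod_list (map p w)) =
      (\<Sum>v\<in>\<pi> ` S. \<Sum>w\<in>{w\<in>S. \<pi> w = v}. prod_list (map p w))"
    by (rule sum.image_gen)
  also have "\<dots> \<le> (\<Sum>v\<in>\<pi> ` S. prod_list (map p v))"
  proof (rule sum_mono)
    fix v assume "v \<in> \<pi> ` S"
    then obtain w where w: "w \<in> S" "v = \<pi> w" by auto
    have "prefix v w" using \<pi> w by simp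
    then have v: "set v \<subseteq> I" using S w(1) set_mono_prefix by fastforce
    have "{w \<in> S. \<pi> w = v} \<subseteq> (\<lambda>u. v @ u) ` words I (n - length v)"
    proof
      fix x assume x: "x \<in> {w \<in> S. \<pi> w = v}"
      then have "prefix v x" using \<pi> by auto
      then obtain u where "x = v @ u" by (auto simp: prefix_def)
      then show "x \<in> (\<lambda>u. v @ u) ` words I (n - length v)" using x S by auto
    qed
    then have "(\<Sum>w\<in>{w\<in>S. \<pi> w = v}. prod_list (map p w)) \<le>
        (\<Sum>w\<in>(\<lambda>u. v @ u) ` words I (n - length v). prod_list (map p w))"
      using fin v pos by (intro sum_mono2) auto
    also have "\<dots> = (\<Sum>u\<in>words I (n - length v). prod_list (map p v) * prod_list (map p u))"
      by (subst sum.reindex) (auto simp: inj_on_def)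
    also have "\<dots> = prod_list (map p v)"
      using sum_words[OF I, of p "n - length v"] sum by (simp add: sum_distrib_left[symmetric])
    finally show "(\<Sum>w\<in>{w\<in>S. \<pi> w = v}. prod_list (map p w)) \<le> prod_list (map p v)" .
  qed
  finally show ?thesis .
qed

text \<open>The shortest prefix whose ratio is at most \<open>t\<close>. The ratio before its last letter still exceeds \<open>t\<close>, and
that letter multiplies it by at least \<open>b\<close>. Minimality makes different stopping prefixes incomparable.\<close>
lemma stopping_prefix:
  fixes c :: "'i \<Rightarrow> real"
  assumes c: "\<And>i. i \<in> I \<Longrightarrow> b \<le> c i \<and> c i \<le> 1" and "0 < b" and "0 < t" "t < 1"
    and w: "set w \<subseteq> I" "prod_list (map c w) \<le> t"
  shows "\<exists>v. prefix v w \<and> prod_list (map c v) \<le> t \<and> b * t \<le> prod_list (map c v) \<and>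
           (\<forall>u. strict_prefix u v \<longrightarrow> t < prod_list (map c u))"
  using w
proof (induction w rule: rev_induct)
  case Nil
  then show ?case using \<open>t < 1\<close> by simp
next
  case (snoc i w)
  show ?case
  proof (cases "prod_list (map c w) \<le> t")
    case True
    then obtain v where "prefix v w \<and> prod_list (map c v) \<le> t \<and> b * t \<le> prod_list (map c v) \<and>
           (\<forall>u. strict_prefix u v \<longrightarrow> t < prod_list (map c u))"
      using snoc by auto
    then show ?thesis by (intro exI[of _ v]) (auto simp: prefix_def)
  next
    case False
    have i: "b \<le> c i" using c snoc.prems(1) by simp
    have "t * b \<le> prod_list (map c w) * c i"
      using False i \<open>0 < b\<close> \<open>0 < t\<close> by (intro mult_mono) auto
    moreover have "t < prod_list (map c u)" if "strict_prefix u (w @ [i])" for u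
    proof -
      have "prefix u w" using that by (auto simp: strict_prefix_def)
      then obtain x where x: "w = u @ x" by (auto simp: prefix_def)
      have le1: "0 \<le> prod_list (map c y) \<and> prod_list (map c y) \<le> 1" if "set y \<subseteq> I" for y
        using that
      proof (induction y)
        case (Cons j y)
        then have "0 \<le> c j" "c j \<le> 1" using c[of j] \<open>0 < b\<close> by auto
        then show ?case using Cons by (auto intro: mult_le_one)
      qed simp
      have "prod_list (map c w) \<le> prod_list (map c u)"
        using le1[of u] le1[of x] snoc.prems(1) x by (simp add: mult_left_le)
      then show ?thesis using False by simp
    qed
    ultimately show ?thesis
      using snoc.prems(2) by (intro exI[of _ "w @ [i]"]) (simp add: mult.commute)
  qed
qed

section \<open>Masses on self-similar sets\<close>

context Metric_space
begin

text \<open>Masses indexed by an arbitrary finite set (of words, below) may be pushed forward to points; different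
indices are allowed to give the same point.\<close>
lemma discrete_frostmanI:
  fixes pt :: "real \<Rightarrow> 'i \<Rightarrow> 'a" and W :: "real \<Rightarrow> 'i set"
  assumes "0 < C"
    and W: "\<And>\<rho>. 0 < \<rho> \<Longrightarrow> \<rho> < 1 \<Longrightarrow> finite (W \<rho>)"
    and pt: "\<And>\<rho> w. 0 < \<rho> \<Longrightarrow> \<rho> < 1 \<Longrightarrow> w \<in> W \<rho> \<Longrightarrow> pt \<rho> w \<in> F \<and> 0 \<le> P \<rho> w"
    and total: "\<And>\<rho>. 0 < \<rho> \<Longrightarrow> \<rho> < 1 \<Longrightarrow> (\<Sum>w\<in>W \<rho>. P \<rho> w) = 1"
    and mass: "\<And>\<rho> t U. 0 < \<rho> \<Longrightarrow> \<rho> \<le> t \<Longrightarrow> t < 1 \<Longrightarrow> \<forall>x\<in>U. \<forall>y\<in>U. d x y \<le> t \<Longrightarrow>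
       (\<Sum>w\<in>{w\<in>W \<rho>. pt \<rho> w \<in> U}. P \<rho> w) \<le> C * t powr s"
  shows "discrete_frostman F s"
  unfolding discrete_frostman_def
proof (intro exI[of _ C] conjI allI impI)
  fix \<rho> :: real assume \<rho>: "0 < \<rho> \<and> \<rho> < 1"
  define A where "A = pt \<rho> ` W \<rho>"
  define p where "p = (\<lambda>a. \<Sum>w\<in>{w\<in>W \<rho>. pt \<rho> w = a}. P \<rho> w)"
  have push: "(\<Sum>a\<in>A \<inter> U. p a) = (\<Sum>w\<in>{w\<in>W \<rho>. pt \<rho> w \<in> U}. P \<rho> w)" for U
  proof -
    let ?S = "{w\<in>W \<rho>. pt \<rho> w \<in> U}"
    have "(\<Sum>w\<in>?S. P \<rho> w) = (\<Sum>a\<in>pt \<rho> ` ?S. \<Sum>w\<in>{w\<in>?S. pt \<rho> w = a}. P \<rho> w)"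
      using W \<rho> by (intro sum.image_gen) auto
    also have "\<dots> = (\<Sum>a\<in>A \<inter> U. p a)"
      unfolding p_def A_def by (intro sum.cong arg_cong2[where f = sum]) auto
    finally show ?thesis ..
  qed
  show "\<exists>A p. finite A \<and> A \<subseteq> F \<and> (\<forall>a\<in>A. 0 \<le> p a) \<and> sum p A = 1 \<and>
      (\<forall>t U. \<rho> \<le> t \<and> t < 1 \<and> (\<forall>x\<in>U. \<forall>y\<in>U. d x y \<le> t) \<longrightarrow> sum p (A \<inter> U) \<le> C * t powr s)"
  proof (intro exI[of _ A] exI[of _ p] conjI ballI allI impI)
    show "finite A" using W \<rho> by (simp add: A_def)
    show "A \<subseteq> F" using pt \<rho> by (auto simp: A_def)
    show "0 \<le> p a" for a unfolding p_def using pt \<rho> by (intro sum_nonneg) auto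
    show "sum p A = 1" using push[of UNIV] total \<rho> by simp
    show "sum p (A \<inter> U) \<le> C * t powr s"
      if "\<rho> \<le> t \<and> t < 1 \<and> (\<forall>x\<in>U. \<forall>y\<in>U. d x y \<le> t)" for t U
      unfolding push using mass that \<rho> by simp
  qed
qed (rule \<open>0 < C\<close>)

lemma foldr_in_space:
  assumes "\<And>i. i \<in> I \<Longrightarrow> f i \<in> M \<rightarrow> M" "set w \<subseteq> I" "x \<in> M"
  shows "foldr f w x \<in> M"
  using assms(2) by (induction w) (use assms(1,3) in auto)

lemma dist_foldr:
  assumes f: "\<And>i. i \<in> I \<Longrightarrow> f i \<in> M \<rightarrow> M"
    and sim: "\<And>i x y. i \<in> I \<Longrightarrow> x \<in> M \<Longrightarrow> y \<in> M \<Longrightarrow> d (f i x) (f i y) = c i * d x y"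
    and "set w \<subseteq> I" "x \<in> M" "y \<in> M"
  shows "d (foldr f w x) (foldr f w y) = prod_list (map c w) * d x y"
  using \<open>set w \<subseteq> I\<close>
proof (induction w)
  case (Cons i w)
  then have "foldr f w x \<in> M" "foldr f w y \<in> M"
    using foldr_in_space[OF f, of I] assms(4,5) by auto
  then show ?case using Cons sim by simp
qed simp

text \<open>Two incomparable words first differ in some letters \<open>i \<noteq> j\<close>; after those letters the images of \<open>V\<close>
lie in the disjoint sets \<open>f i ` V\<close> and \<open>f j ` V\<close>, and the common prefix acts injectively.\<close>
lemma foldr_images_disjoint:
  assumes f: "\<And>i. i \<in> I \<Longrightarrow> f i \<in> M \<rightarrow> M" and inj: "\<And>i. i \<in> I \<Longrightarrow> inj_on (f i) M"
    and V: "V \<subseteq> M" "\<And>i. i \<in> I \<Longrightarrow> f i ` V \<subseteq> V"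
    and disj: "\<And>i j. i \<in> I \<Longrightarrow> j \<in> I \<Longrightarrow> i \<noteq> j \<Longrightarrow> f i ` V \<inter> f j ` V = {}"
    and v: "set v \<subseteq> I" "set v' \<subseteq> I" "v \<parallel> v'"
  shows "foldr f v ` V \<inter> foldr f v' ` V = {}"
proof -
  obtain u i x j y where ij: "i \<noteq> j" "v = u @ i # x" "v' = u @ j # y"
    using parallel_decomp[OF v(3)] by auto
  have sub: "foldr f w z \<in> V" if "set w \<subseteq> I" "z \<in> V" for w z
    using that by (induction w) (use V(2) in auto)
  have inj_u: "z = z'" if "set w \<subseteq> I" "z \<in> M" "z' \<in> M" "foldr f w z = foldr f w z'" for w z z'
    using that
  proof (induction w)
    case (Cons k w)
    then have "foldr f w z \<in> M" "foldr f w z' \<in> M"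
      using foldr_in_space[OF f, of I] by auto
    then have "foldr f w z = foldr f w z'"
      using inj_onD[OF inj[of k]] Cons.prems by auto
    then show ?case using Cons by auto
  qed simp
  show ?thesis
  proof (rule ccontr)
    assume "\<not> ?thesis"
    then obtain z z' where z: "z \<in> V" "z' \<in> V" "foldr f v z = foldr f v' z'" by auto
    define a where "a = f i (foldr f x z)"
    define a' where "a' = f j (foldr f y z')"
    have a: "a \<in> f i ` V" "a' \<in> f j ` V"
      using sub z v ij by (auto simp: a_def a'_def)
    then have "a \<in> M" "a' \<in> M" using V v ij by auto
    moreover have "foldr f u a = foldr f u a'" using z(3) by (simp add: ij a_def a'_def)
    ultimately have "a = a'" using inj_u v ij by auto
    then show False using a disj[of i j] v ij by auto
  qed
qed

end

text \<open>Moran's argument. At resolution \<open>\<rho>\<close> the word \<open>w\<close>, of a length for which all ratios are below \<open>\<rho>\<close>, puts the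
mass \<open>(prod_list (map c w)) powr s\<close> on the point \<open>foldr f w g0\<close> of the attractor. Given a set \<open>U\<close> of diameter
at most \<open>t\<close>, each word with its point in \<open>U\<close> is cut off at its stopping prefix \<open>v\<close>, which has ratio
comparable with \<open>t\<close> and hence weight at most \<open>t powr s\<close>. It remains to bound the number of these prefixes. They
are incomparable, so the images \<open>foldr f v ` V\<close> of the open set are disjoint. As similarities
are surjective, the image contains the whole ball of radius \<open>a * prod_list (map c v)\<close> around
\<open>foldr f v x0\<close>, where \<open>V\<close> contains the ball of radius \<open>a\<close> around \<open>x0\<close>. Hence these centres are separated by
a multiple of \<open>t\<close>; they also lie within a multiple of \<open>t\<close> from \<open>U\<close>, so their number is bounded by doubling.\<close>
lemma discrete_frostman_attractor:
  assumes comp: "Metric_space.mcomplete (eucl n) (eucl_dist n)" and I: "finite I"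
    and sim: "\<And>i. i \<in> I \<Longrightarrow> Metric_space.contraction_similarity (eucl n) (eucl_dist n) (f i) (c i)"
    and osc: "Metric_space.open_set_condition (eucl n) (eucl_dist n) I f"
    and att: "Metric_space.is_attractor (eucl n) (eucl_dist n) I f G"
    and sum: "(\<Sum>i\<in>I. c i powr s) = 1"
  shows "Metric_space.discrete_frostman (eucl_dist n) G s"
proof -
  interpret Metric_space "eucl n" "eucl_dist n" by (rule Metric_space_eucl)
  have c: "\<And>i. i \<in> I \<Longrightarrow> 0 \<le> c i \<and> c i < 1"
    and fM: "\<And>i. i \<in> I \<Longrightarrow> f i \<in> eucl n \<rightarrow> eucl n"
    and fd: "\<And>i x y. i \<in> I \<Longrightarrow> x \<in> eucl n \<Longrightarrow> y \<in> eucl n \<Longrightarrow>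
      eucl_dist n (f i x) (f i y) = c i * eucl_dist n x y"
    using sim unfolding contraction_similarity_def by auto
  have s: "0 \<le> s" using similarity_exponent_nonneg[OF I c sum] .
  \<comment> \<open>maps of ratio 0 have weight 0, and without them all maps are injective and onto\<close>
  define J where "J = {i\<in>I. c i > 0}"
  have J: "finite J" "J \<subseteq> I" "\<And>i. i \<in> J \<Longrightarrow> 0 < c i" using I by (auto simp: J_def)
  have JI: "i \<in> J \<Longrightarrow> i \<in> I" for i using J(2) by auto
  have sumJ: "(\<Sum>i\<in>J. c i powr s) = 1"
  proof -
    have "(\<Sum>i\<in>J. c i powr s) = (\<Sum>i\<in>I. c i powr s)"
      using I c by (intro sum.mono_neutral_left) (auto simp: J_def less_le)
    then show ?thesis using sum by simp
  qed
  have fJ: "\<And>i. i \<in> J \<Longrightarrow> f i \<in> eucl n \<rightarrow> eucl n"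
    and dJ: "\<And>i x y. i \<in> J \<Longrightarrow> x \<in> eucl n \<Longrightarrow> y \<in> eucl n \<Longrightarrow>
      eucl_dist n (f i x) (f i y) = c i * eucl_dist n x y"
    using fM fd JI by auto
  have injJ: "inj_on (f i) (eucl n)" if "i \<in> J" for i
  proof (rule inj_onI)
    fix x y assume xy: "x \<in> eucl n" "y \<in> eucl n" "f i x = f i y"
    then have "f i y \<in> eucl n" using fJ[OF that] by auto
    then have "c i * eucl_dist n x y = 0"
      using dJ[OF that xy(1,2)] xy(3) by (metis zero)
    then show "x = y" using J(3)[OF that] xy by simp
  qed
  have surj: "eucl n \<subseteq> foldr f v ` eucl n" if "set v \<subseteq> J" for v
    using that
  proof (induction v)
    case (Cons i v)
    have "eucl n \<subseteq> f i ` eucl n"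
      using Cons.prems by (intro similarity_surj[OF comp fJ J(3) dJ]) auto
    also have "\<dots> \<subseteq> f i ` foldr f v ` eucl n" using Cons by (intro image_mono) auto
    finally show ?case by (simp add: image_comp)
  qed simp
  obtain b where b: "0 < b" "b < 1" "\<And>i. i \<in> J \<Longrightarrow> c i \<le> b"
    using finite_ratio_bound[OF J(1), of c] c JI by blast
  define b' where "b' = Min (insert 1 (c ` J))"
  have b': "0 < b'" "\<And>i. i \<in> J \<Longrightarrow> b' \<le> c i"
  proof -
    show "0 < b'" unfolding b'_def using J by (subst Min_gr_iff) auto
    show "b' \<le> c i" if "i \<in> J" for i unfolding b'_def using J(1) that by (intro Min_le) auto
  qed
  obtain V where V: "V \<noteq> {}" "openin mtopology V" "(\<Union>i\<in>I. f i ` V) \<subseteq> V"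
    "\<forall>i\<in>I. \<forall>j\<in>I. i \<noteq> j \<longrightarrow> f i ` V \<inter> f j ` V = {}"
    using osc unfolding open_set_condition_def by (elim exE conjE)
  have VM: "V \<subseteq> eucl n" using V(2) by (auto simp: openin_mtopology)
  obtain x0 where x0V: "x0 \<in> V" using V(1) by auto
  then have x0: "x0 \<in> eucl n" using VM by auto
  obtain a where a: "0 < a" "mball x0 a \<subseteq> V" using V(2) x0V by (auto simp: openin_mtopology)
  have G: "G \<noteq> {}" "compactin mtopology G" "G = (\<Union>i\<in>I. f i ` G)"
    using att unfolding is_attractor_def by simp_all
  have GM: "G \<subseteq> eucl n" using compactin_subset_topspace[OF G(2)] by simp
  obtain g0 where g0: "g0 \<in> G" using G(1) by auto
  have foldrG: "foldr f w g \<in> G" if "set w \<subseteq> J" "g \<in> G" for w g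
    using that by (induction w) (use G(3) JI in auto)
  have "mbounded G" using G(2) by (rule compactin_imp_mbounded)
  then obtain D where "0 < D" and D: "\<And>y. y \<in> G \<Longrightarrow> eucl_dist n x0 y \<le> D"
  proof -
    obtain z B where "G \<subseteq> mcball z B" using \<open>mbounded G\<close> by (auto simp: mbounded_def)
    then have z: "z \<in> eucl n" "\<And>y. y \<in> G \<Longrightarrow> eucl_dist n z y \<le> B" using g0 by auto
    have "eucl_dist n x0 y \<le> \<bar>eucl_dist n x0 z + B\<bar> + 1" if "y \<in> G" for y
      using triangle[OF x0 z(1), of y] z(2)[OF that] GM that by fastforce
    then show thesis by (intro that[of "\<bar>eucl_dist n x0 z + B\<bar> + 1"]) auto
  qed
  define L where "L = (D + 1) / (a * b')"
  obtain B where B: "\<And>S z R \<delta>. 0 < \<delta> \<Longrightarrow> R \<le> L * \<delta> \<Longrightarrow> \<forall>x\<in>S. eucl_dist n z x \<le> R \<Longrightarrow>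
    \<forall>x\<in>S. \<forall>y\<in>S. x \<noteq> y \<longrightarrow> \<delta> \<le> eucl_dist n x y \<Longrightarrow> card S \<le> B"
    by (rule separated_card_bounded) (rule that)
  define P where "P = (\<lambda>w. prod_list (map (\<lambda>i. c i powr s) w))"
  have P_pos: "0 \<le> P w" if "set w \<subseteq> J" for w unfolding P_def by (induction w) auto
  have c_pos: "0 < prod_list (map c w)" if "set w \<subseteq> J" for w
    using that J(3) by (induction w) auto
  have P_powr: "P w = prod_list (map c w) powr s" if "set w \<subseteq> J" for w
    using that
  proof (induction w)
    case (Cons i w)
    then show ?case using c_pos[of w] J(3)[of i] by (simp add: P_def powr_mult)
  qed (simp add: P_def)
  have c_le: "prod_list (map c w) \<le> b ^ length w" if "set w \<subseteq> J" for w
    using that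
  proof (induction w)
    case (Cons i w)
    then show ?case
      using b J(3)[of i] c_pos[of w] by (simp add: mult_mono)
  qed simp
  have separated: "a * prod_list (map c v) \<le> eucl_dist n (foldr f v x0) (foldr f v' x0)"
    if v: "set v \<subseteq> J" "set v' \<subseteq> J" "v \<parallel> v'" for v v'
  proof (rule ccontr)
    assume less: "\<not> ?thesis"
    have "foldr f v' x0 \<in> eucl n" using foldr_in_space[OF fJ v(2) x0] .
    then obtain z where z: "z \<in> eucl n" "foldr f v' x0 = foldr f v z"
      using surj[OF v(1)] by auto
    have "prod_list (map c v) * eucl_dist n x0 z < prod_list (map c v) * a"
      using less dist_foldr[OF fJ dJ v(1) x0 z(1)] by (simp add: z(2) mult.commute)
    then have "z \<in> V" using a(2) x0 z(1) c_pos[OF v(1)] by auto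
    then have "foldr f v' x0 \<in> foldr f v ` V" unfolding z(2) by (rule imageI)
    moreover have "foldr f v' x0 \<in> foldr f v' ` V" using x0V by (rule imageI)
    moreover have "foldr f v ` V \<inter> foldr f v' ` V = {}"
      by (rule foldr_images_disjoint[OF fJ injJ VM _ _ v]) (use V(3,4) JI in blast)+
    ultimately show False by blast
  qed
  define N where "N = (\<lambda>\<rho>. SOME k. b ^ k < \<rho>)"
  have N: "b ^ N \<rho> < \<rho>" if "0 < \<rho>" for \<rho>
    unfolding N_def using real_arch_pow_inv[OF that b(2)] by (rule someI_ex)
  show ?thesis
  proof (rule discrete_frostmanI[where C = "real B + 1" and W = "\<lambda>\<rho>. words J (N \<rho>)"
        and pt = "\<lambda>\<rho> w. foldr f w g0" and P = "\<lambda>\<rho>. P"])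
    fix \<rho> :: real assume "0 < \<rho>"
    show "finite (words J (N \<rho>))" using J(1) by (rule finite_lists_length_eq)
    show "foldr f w g0 \<in> G \<and> 0 \<le> P w" if "w \<in> words J (N \<rho>)" for w
      using that foldrG[OF _ g0] P_pos by simp
    show "(\<Sum>w\<in>words J (N \<rho>). P w) = 1"
      unfolding P_def by (simp add: sum_words[OF J(1)] sumJ)
    fix t :: real and U
    assume t: "\<rho> \<le> t" "t < 1" and U: "\<forall>x\<in>U. \<forall>y\<in>U. eucl_dist n x y \<le> t"
    have "0 < t" using \<open>0 < \<rho>\<close> t by simp
    define S where "S = {w \<in> words J (N \<rho>). foldr f w g0 \<in> U}"
    have SJ: "set w \<subseteq> J" if "w \<in> S" for w using that by (simp add: S_def)
    have "\<forall>w\<in>S. \<exists>v. prefix v w \<and> prod_list (map c v) \<le> t \<and> b' * t \<le> prod_list (map c v) \<and>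
           (\<forall>u. strict_prefix u v \<longrightarrow> t < prod_list (map c u))"
    proof
      fix w assume w: "w \<in> S"
      have "prod_list (map c w) \<le> b ^ N \<rho>" using c_le[OF SJ[OF w]] w by (simp add: S_def)
      then have "prod_list (map c w) \<le> t" using N[OF \<open>0 < \<rho>\<close>] t by simp
      moreover have "\<And>i. i \<in> J \<Longrightarrow> b' \<le> c i \<and> c i \<le> 1" using b' c JI by (meson less_imp_le)
      ultimately show "\<exists>v. prefix v w \<and> prod_list (map c v) \<le> t \<and> b' * t \<le> prod_list (map c v) \<and>
           (\<forall>u. strict_prefix u v \<longrightarrow> t < prod_list (map c u))"
        using b'(1) \<open>0 < t\<close> t(2) SJ[OF w] by (intro stopping_prefix[where I = J])
    qed
    from bchoice[OF this] obtain \<pi> where \<pi>: "\<And>w. w \<in> S \<Longrightarrow> prefix (\<pi> w) w"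
      "\<And>w. w \<in> S \<Longrightarrow> prod_list (map c (\<pi> w)) \<le> t"
      "\<And>w. w \<in> S \<Longrightarrow> b' * t \<le> prod_list (map c (\<pi> w))"
      "\<And>w u. w \<in> S \<Longrightarrow> strict_prefix u (\<pi> w) \<Longrightarrow> t < prod_list (map c u)"
      by auto
    have \<pi>J: "set (\<pi> w) \<subseteq> J" if "w \<in> S" for w
      using set_mono_prefix[OF \<pi>(1)[OF that]] SJ[OF that] by simp
    have par: "\<pi> w \<parallel> \<pi> w'" if "w \<in> S" "w' \<in> S" "\<pi> w \<noteq> \<pi> w'" for w w'
    proof (rule parallelI)
      show "\<not> prefix (\<pi> w) (\<pi> w')"
        using \<pi>(4)[OF that(2), of "\<pi> w"] \<pi>(2)[OF that(1)] that(3) by (auto simp: strict_prefix_def)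
      show "\<not> prefix (\<pi> w') (\<pi> w)"
        using \<pi>(4)[OF that(1), of "\<pi> w'"] \<pi>(2)[OF that(2)] that(3) by (auto simp: strict_prefix_def)
    qed
    define \<delta> where "\<delta> = a * b' * t"
    have "0 < \<delta>" using a b' \<open>0 < t\<close> by (simp add: \<delta>_def)
    have sep: "\<delta> \<le> eucl_dist n (foldr f v x0) (foldr f v' x0)"
      if "v \<in> \<pi> ` S" "v' \<in> \<pi> ` S" "v \<noteq> v'" for v v'
    proof -
      obtain w w' where w: "w \<in> S" "w' \<in> S" "v = \<pi> w" "v' = \<pi> w'" using \<open>v \<in> \<pi> ` S\<close> \<open>v' \<in> \<pi> ` S\<close> by auto
      have "\<delta> = a * (b' * t)" by (simp add: \<delta>_def)
      also have "\<dots> \<le> a * prod_list (map c v)"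
        using \<pi>(3)[OF w(1)] a(1) by (simp add: w)
      also have "\<dots> \<le> eucl_dist n (foldr f v x0) (foldr f v' x0)"
        using separated[of v v'] w \<pi>J par \<open>v \<noteq> v'\<close> by simp
      finally show ?thesis .
    qed
    have card: "card (\<pi> ` S) \<le> B"
    proof (cases "S = {}")
      case False
      then obtain w0 where w0: "w0 \<in> S" by auto
      define T where "T = (\<lambda>v. foldr f v x0) ` \<pi> ` S"
      have "inj_on (\<lambda>v. foldr f v x0) (\<pi> ` S)"
      proof (rule inj_onI, rule ccontr)
        fix v v' assume v: "v \<in> \<pi> ` S" "v' \<in> \<pi> ` S" "foldr f v x0 = foldr f v' x0" "v \<noteq> v'"
        have v'J: "set v' \<subseteq> J" using v(2) \<pi>J by auto
        have "foldr f v' x0 \<in> eucl n" by (rule foldr_in_space[OF fJ v'J x0])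
        then show False using sep[OF v(1,2,4)] v(3) \<open>0 < \<delta>\<close> by simp
      qed
      then have "card (\<pi> ` S) = card T" by (simp add: T_def card_image)
      also have "card T \<le> B"
      proof (rule B[OF \<open>0 < \<delta>\<close>])
        show "(D + 1) * t \<le> L * \<delta>" using a b' by (simp add: L_def \<delta>_def)
        show "\<forall>x\<in>T. eucl_dist n (foldr f w0 g0) x \<le> (D + 1) * t"
        proof
          fix x assume "x \<in> T"
          then obtain w where w: "w \<in> S" "x = foldr f (\<pi> w) x0" by (auto simp: T_def)
          obtain u where u: "w = \<pi> w @ u" using \<pi>(1)[OF w(1)] by (auto simp: prefix_def)
          have uJ: "set u \<subseteq> J" using SJ[OF w(1)] u by (metis le_sup_iff set_append)
          define y where "y = foldr f u g0"
          have y: "y \<in> G" unfolding y_def using foldrG[OF uJ g0] .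
          have wy: "foldr f w g0 = foldr f (\<pi> w) y" unfolding y_def by (subst u) simp
          have mem: "foldr f w0 g0 \<in> eucl n" "foldr f w g0 \<in> eucl n" "x \<in> eucl n"
            using foldrG[OF SJ[OF w0] g0] foldrG[OF SJ[OF w(1)] g0] GM
              foldr_in_space[OF fJ \<pi>J[OF w(1)] x0] w(2) by auto
          have "eucl_dist n (foldr f w0 g0) (foldr f w g0) \<le> t"
            using U w0 w(1) by (simp add: S_def)
          moreover have "eucl_dist n (foldr f w g0) x \<le> D * t"
          proof -
            have "eucl_dist n x (foldr f w g0) = prod_list (map c (\<pi> w)) * eucl_dist n x0 y"
              unfolding w(2) wy using y GM by (intro dist_foldr[OF fJ dJ \<pi>J[OF w(1)] x0]) auto
            also have "\<dots> \<le> t * D"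
              using \<pi>(2)[OF w(1)] D[OF y] \<open>0 < t\<close> by (intro mult_mono) auto
            finally show ?thesis by (simp add: commute mult.commute)
          qed
          ultimately show "eucl_dist n (foldr f w0 g0) x \<le> (D + 1) * t"
            using triangle[OF mem] by (simp add: distrib_right)
        qed
        show "\<forall>x\<in>T. \<forall>y\<in>T. x \<noteq> y \<longrightarrow> \<delta> \<le> eucl_dist n x y"
        proof (intro ballI impI)
          fix x y assume xy: "x \<in> T" "y \<in> T" "x \<noteq> y"
          obtain v where v: "v \<in> \<pi> ` S" "x = foldr f v x0"
            using xy(1) unfolding T_def by (rule imageE) (rule that)
          obtain v' where v': "v' \<in> \<pi> ` S" "y = foldr f v' x0"
            using xy(2) unfolding T_def by (rule imageE) (rule that)
          have "v \<noteq> v'" using \<open>x \<noteq> y\<close> v(2) v'(2) by auto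
          then show "\<delta> \<le> eucl_dist n x y" unfolding v(2) v'(2) by (rule sep[OF v(1) v'(1)])
        qed
      qed
      finally show ?thesis .
    qed simp
    have "(\<Sum>w\<in>S. P w) \<le> (\<Sum>v\<in>\<pi> ` S. P v)"
      unfolding P_def
    proof (rule sum_words_le_sum_prefixes[OF J(1) _ sumJ _ \<pi>(1)])
      show "S \<subseteq> words J (N \<rho>)" by (auto simp: S_def)
    qed auto
    also have "\<dots> \<le> (\<Sum>v\<in>\<pi> ` S. t powr s)"
    proof (rule sum_mono)
      fix v assume "v \<in> \<pi> ` S"
      then obtain w where w: "w \<in> S" "v = \<pi> w" by auto
      then show "P v \<le> t powr s"
        using \<pi>J[OF w(1)] \<pi>(2)[OF w(1)] c_pos[of v] s by (simp add: P_powr powr_mono2)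
    qed
    also have "\<dots> = card (\<pi> ` S) * t powr s" by simp
    also have "\<dots> \<le> (real B + 1) * t powr s"
      using card by (intro mult_right_mono) auto
    finally show "(\<Sum>w\<in>{w \<in> words J (N \<rho>). foldr f w g0 \<in> U}. P w) \<le> (real B + 1) * t powr s"
      by (simp only: S_def)
  qed simp
qed

section \<open>Dimension of the product\<close>

theorem theorem3p6:
  fixes m :: nat
    and n N :: "nat \<Rightarrow> nat"
    and w :: "nat \<Rightarrow> nat \<Rightarrow> (nat \<Rightarrow> real) \<Rightarrow> (nat \<Rightarrow> real)"
    and c :: "nat \<Rightarrow> nat \<Rightarrow> real"
    and s :: "nat \<Rightarrow> real"
    and G :: "nat \<Rightarrow> (nat \<Rightarrow> real) set"
    and F :: "(nat \<Rightarrow> nat \<Rightarrow> real) set"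
    and X :: "(nat \<Rightarrow> nat \<Rightarrow> real) set"
    and d0 :: "(nat \<Rightarrow> nat \<Rightarrow> real) \<Rightarrow> (nat \<Rightarrow> nat \<Rightarrow> real) \<Rightarrow> real"
  assumes "1 \<le> m"
    and "\<And>k. k \<in> {1..m} \<Longrightarrow> Metric_space.IFS (eucl (n k)) (eucl_dist (n k)) {1..N k} (w k)"
    and "\<And>k i. k \<in> {1..m} \<Longrightarrow> i \<in> {1..N k} \<Longrightarrow>
           Metric_space.contraction_similarity (eucl (n k)) (eucl_dist (n k)) (w k i) (c k i)"
    and "\<And>k. k \<in> {1..m} \<Longrightarrow>
           Metric_space.open_set_condition (eucl (n k)) (eucl_dist (n k)) {1..N k} (w k)"
    and "\<And>k. k \<in> {1..m} \<Longrightarrow>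
           Metric_space.is_attractor (eucl (n k)) (eucl_dist (n k)) {1..N k} (w k) (G k)"
    and X: "X = Pi\<^sub>E {1..m} (\<lambda>k. eucl (n k))"
    and d0: "d0 = L2_prod_dist {1..m} (\<lambda>k. eucl_dist (n k))"
    and "F = Pi\<^sub>E {1..m} G"
    and "Metric_space.is_attractor X d0
           (Pi\<^sub>E {1..m} (\<lambda>k. {1..N k})) (prod_map {1..m} w) F"
    and "\<And>k. k \<in> {1..m} \<Longrightarrow> (\<Sum>i=1..N k. c k i powr s k) = 1"
  shows "Metric_space.hausdorff_dim X d0 F = ereal (\<Sum>k=1..m. s k) \<and>
         Metric_space.has_box_dim X d0 F (ereal (\<Sum>k=1..m. s k))"
proof -
  let ?K = "{1..m}" and ?X = "\<lambda>k. eucl (n k)" and ?d = "\<lambda>k. eucl_dist (n k)"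
  have sp: "\<And>k. k \<in> ?K \<Longrightarrow> Metric_space (?X k) (?d k)"
    by (rule Metric_space_eucl)
  interpret P: Metric_space X d0
    unfolding X d0 by (rule Metric_space_L2_prod[OF _ sp]) simp
  have nonneg: "0 \<le> s k" if k: "k \<in> ?K" for k
  proof (rule similarity_exponent_nonneg[OF _ _ assms(10)[OF k]])
    show "0 \<le> c k i \<and> c k i < 1" if "i \<in> {1..N k}" for i
      using assms(3)[OF k that] by (simp add: Metric_space.contraction_similarity_def[OF sp[OF k]])
  qed simp
  have G: "G k \<subseteq> ?X k" if k: "k \<in> ?K" for k
  proof -
    interpret Metric_space "?X k" "?d k" by (rule sp[OF k])
    show ?thesis
      using assms(5)[OF k] compactin_subset_topspace[of mtopology "G k"] by (simp add: is_attractor_def)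
  qed
  have upper: "Metric_space.covering_exponent_le (?X k) (?d k) (G k) (s k)" if k: "k \<in> ?K" for k
    by (rule Metric_space.covering_exponent_le_attractor[OF sp[OF k] _ assms(3)[OF k] assms(5)[OF k] assms(10)[OF k]])
      simp_all
  have lower: "Metric_space.discrete_frostman (?d k) (G k) (s k)" if k: "k \<in> ?K" for k
  proof (rule discrete_frostman_attractor[OF _ _ assms(3)[OF k] assms(4)[OF k] assms(5)[OF k] assms(10)[OF k]])
    show "Metric_space.mcomplete (?X k) (?d k)"
      using assms(2)[OF k] by (simp add: Metric_space.IFS_def[OF sp[OF k]])
  qed simp_all
  show ?thesis
  proof (rule P.dims_eqI)
    show "compactin P.mtopology F"
      using assms(9) by (simp add: P.is_attractor_def)
    show "0 \<le> (\<Sum>k=1..m. s k)" using nonneg by (intro sum_nonneg)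
    show "P.covering_exponent_le F (\<Sum>k=1..m. s k)"
      unfolding X d0 assms(8) using \<open>1 \<le> m\<close>
      by (intro covering_exponent_le_L2_prod sp upper) auto
    show "P.discrete_frostman F (\<Sum>k=1..m. s k)"
      unfolding d0 assms(8) by (rule discrete_frostman_L2_prod[OF _ sp G lower]) simp
  qed
qed

end
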